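(* Let $G\subset GL(d,\mathbb C)$ be a reductive algebraic matrix group and let $H\subset G$ be a cyclic group of order $m$ consisting of scalar matrices. Let $F_N$ be the free group on $\gamma_1,\dots,\gamma_N$, and suppose that $\mathbb C[X_G(F_N)]$ is generated as a $\mathbb C$-algebra by the functions $\tau_g$ for $g$ in a set $B\subset F_N$. Let $\mathcal M'$ be the set of all functions $\lambda_{g_1,\dots,g_k}$ such that $g_1,\dots,g_k\in B$ and $\{v(g_1),\dots,v(g_k)\}\in\mathcal V(m,N)$. Then $\mathbb C[X_{G/H}(F_N)]$ is generated as a $\mathbb C$-algebra by the elements of $\mathcal M'$.
   Context: For an affine reductive algebraic group $G$ over $\mathbb C$, $Hom(F_N,G)=G^N$, $G$ acts on it by simultaneous conjugation, and $X_G(F_N)=G^N//G$ is the categorical quotient, so $\mathbb C[X_G(F_N)]=\mathbb C[G^N]^G$. For $g\in F_N$, $\tau_g([\rho])=\mathrm{tr}(\rho(g))$. For $\gamma\in F_N$, $v(\gamma)\in(\mathbb Z/m)^N$ is the vector whose $i$-th component is the sum (mod $m$) of the exponents of $\gamma_i$ in $\gamma$. Let $\psi:X_G(F_N)\to X_{G/H}(F_N)$ be the map induced by the projection $G\to G/H$. If $\sum_{i=1}^k v(g_i)=0$, then $\lambda_{g_1,\dots,g_k}\in\mathbb C[X_{G/H}(F_N)]$ denotes the unique function with $\tau_{g_1}\cdots\tau_{g_k}=\lambda_{g_1,\dots,g_k}\circ\psi$. $\mathcal V(m,N)$ is the set of all (non-empty, finite) multisets $\{v_1,\dots,v_k\}$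 of vectors in $(\mathbb Z/m)^N$ such that $\sum_{i=1}^k v_i=0$ but no proper non-empty submultiset of $\{v_1,\dots,v_k\}$ adds up to $0$. *)

theory Defs
  imports "HOL-Analysis.Determinants" "HOL-Algebra.Elementary_Groups" "HOL-Library.Multiset"
begin

section \<open>Algebras of complex-valued functions\<close>

text \<open>
  Functions on a set \<open>X\<close> are represented by elements of \<^term>\<open>extensional X\<close>, so that two of them
  are equal iff they agree on \<open>X\<close>.
\<close>

inductive_set alg_generated :: "'x set \<Rightarrow> ('x \<Rightarrow> complex) set \<Rightarrow> ('x \<Rightarrow> complex) set"
  for X :: "'x set" and S :: "('x \<Rightarrow> complex) set" where
  const: "(\<lambda>x\<in>X. c) \<in> alg_generated X S"
| gen: "f \<in> S \<Longrightarrow> f \<in> alg_generated X S"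
| add: "f \<in> alg_generated X S \<Longrightarrow> g \<in> alg_generated X S \<Longrightarrow> (\<lambda>x\<in>X. f x + g x) \<in> alg_generated X S"
| mult: "f \<in> alg_generated X S \<Longrightarrow> g \<in> alg_generated X S \<Longrightarrow> (\<lambda>x\<in>X. f x * g x) \<in> alg_generated X S"


section \<open>Reductive algebraic matrix groups\<close>

type_synonym 'd cmat = "complex ^ 'd ^ 'd"

definition matrix_group :: "('d::finite) cmat set \<Rightarrow> 'd cmat monoid" where
  "matrix_group S = \<lparr>carrier = S, mult = (**), one = mat 1\<rparr>"

definition GL :: "('d::finite) cmat monoid" where
  "GL = matrix_group {A. invertible A}"

definition entries :: "('d::finite) cmat set \<Rightarrow> ('d cmat \<Rightarrow> complex) set" where
  "entries S = {\<lambda>A\<in>S. A $ i $ j | i j. True}"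

definition zariski_closed :: "('d::finite) cmat set \<Rightarrow> bool" where
  "zariski_closed S \<longleftrightarrow>
     (\<exists>P \<subseteq> alg_generated UNIV (entries UNIV). S = {A \<in> carrier GL. \<forall>p\<in>P. p A = 0})"

definition zariski_connected :: "('d::finite) cmat set \<Rightarrow> bool" where
  "zariski_connected S \<longleftrightarrow>
     \<not> (\<exists>C D. zariski_closed C \<and> zariski_closed D \<and> S \<subseteq> C \<union> D \<and>
             S \<inter> C \<noteq> {} \<and> S \<inter> D \<noteq> {} \<and> S \<inter> C \<inter> D = {})"

text \<open>
  Iterated matrix multiplication is used because \<open>^\<close> on \<^typ>\<open>'d cmat\<close> is the entrywise power.
\<close>

definition unipotent :: "('d::finite) cmat \<Rightarrow> bool" where
  "unipotent A \<longleftrightarrow> (\<exists>k. (((**) (A - mat 1)) ^^ k) (mat 1) = 0)"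

text \<open>
  The last condition says that the unipotent radical, i.e. the largest connected normal unipotent
  closed subgroup, is trivial. The group itself need not be connected.
\<close>

definition reductive_matrix_group :: "('d::finite) cmat set \<Rightarrow> bool" where
  "reductive_matrix_group G \<longleftrightarrow>
     subgroup G GL \<and> zariski_closed G \<and>
     (\<forall>U. U \<lhd> matrix_group G \<and> zariski_closed U \<and> zariski_connected U \<and> (\<forall>A\<in>U. unipotent A)
          \<longrightarrow> U = {mat 1})"

text \<open>
  The coordinate ring of a closed subgroup of the general linear group: restrictions of elements of
  \<open>\<complex>[x\<^sub>i\<^sub>j, 1/det]\<close>.
\<close>

definition matrix_coord_ring :: "('d::finite) cmat set \<Rightarrow> ('d cmat \<Rightarrow> complex) set" where
  "matrix_coord_ring G = alg_generated G (insert (\<lambda>A\<in>G. 1 / det A) (entries G))"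

text \<open>
  The quotient group \<open>G/H\<close> has as elements the cosets of \<open>H\<close>; its regular functions are the
  functions whose pullback along the projection \<open>G \<rightarrow> G/H\<close> is regular on \<open>G\<close>.
\<close>

definition proj :: "('d::finite) cmat set \<Rightarrow> 'd cmat set \<Rightarrow> 'd cmat \<Rightarrow> 'd cmat set" where
  "proj G H A = H #>\<^bsub>matrix_group G\<^esub> A"

definition quotient_coord_ring :: "('d::finite) cmat set \<Rightarrow> 'd cmat set \<Rightarrow> ('d cmat set \<Rightarrow> complex) set" where
  "quotient_coord_ring G H =
     {f \<in> extensional (carrier (matrix_group G Mod H)). (\<lambda>A\<in>G. f (proj G H A)) \<in> matrix_coord_ring G}"


section \<open>The free group\<close>

text \<open>
  Elements are the reduced words in the letters \<open>(i, True)\<close>, standing for the generator number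
  \<open>i < N\<close>, and \<open>(i, False)\<close>, standing for its inverse.
\<close>

type_synonym letter = "nat \<times> bool"

definition inv_letter :: "letter \<Rightarrow> letter" where
  "inv_letter a = (fst a, \<not> snd a)"

fun reduced :: "letter list \<Rightarrow> bool" where
  "reduced [] = True"
| "reduced [a] = True"
| "reduced (a # b # w) = (b \<noteq> inv_letter a \<and> reduced (b # w))"

fun cons_cancel :: "letter \<Rightarrow> letter list \<Rightarrow> letter list" where
  "cons_cancel a [] = [a]"
| "cons_cancel a (b # w) = (if b = inv_letter a then w else a # b # w)"

definition free_group :: "nat \<Rightarrow> letter list monoid" where
  "free_group N = \<lparr>carrier = {w. reduced w \<and> fst ` set w \<subseteq> {..<N}}, mult = foldr cons_cancel, one = []\<rparr>"

definition letter_eval :: "('g, 'x) monoid_scheme \<Rightarrow> (nat \<Rightarrow> 'g) \<Rightarrow> letter \<Rightarrow> 'g" where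
  "letter_eval \<Gamma> A a = (if snd a then A (fst a) else inv\<^bsub>\<Gamma>\<^esub> (A (fst a)))"

text \<open>
  \<open>word_eval \<Gamma> A\<close> is the homomorphism from the free group to \<open>\<Gamma>\<close> that maps the \<open>i\<close>-th generator
  to \<open>A i\<close>.
\<close>

definition word_eval :: "('g, 'x) monoid_scheme \<Rightarrow> (nat \<Rightarrow> 'g) \<Rightarrow> letter list \<Rightarrow> 'g" where
  "word_eval \<Gamma> A w = foldr (\<lambda>a x. letter_eval \<Gamma> A a \<otimes>\<^bsub>\<Gamma>\<^esub> x) w \<one>\<^bsub>\<Gamma>\<^esub>"

lemma inv_letter_inv_letter [simp]: "inv_letter (inv_letter a) = a"
  by (simp add: inv_letter_def)

lemma fst_inv_letter [simp]: "fst (inv_letter a) = fst a"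
  by (simp add: inv_letter_def)

lemma inv_letter_neq [simp]: "inv_letter a \<noteq> a" "a \<noteq> inv_letter a"
  by (auto simp: inv_letter_def prod_eq_iff)

lemma reduced_tl: "reduced (a # w) \<Longrightarrow> reduced w"
  by (cases w) auto

lemma reduced_cons_cancel: "reduced w \<Longrightarrow> reduced (cons_cancel a w)"
  by (cases w) (auto dest: reduced_tl)

lemma reduced_foldr: "reduced w \<Longrightarrow> reduced (foldr cons_cancel u w)"
  by (induction u) (auto intro: reduced_cons_cancel)

lemma cons_cancel_cancel: "reduced w \<Longrightarrow> cons_cancel a (cons_cancel (inv_letter a) w) = w"
  by (cases w rule: reduced.cases) auto

lemma set_cons_cancel: "set (cons_cancel a w) \<subseteq> insert a (set w)"
  by (cases w) auto

lemma set_foldr: "set (foldr cons_cancel u w) \<subseteq> set u \<union> set w"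
  using set_cons_cancel by (induction u) fastforce+

lemma foldr_cons_cancel:
  assumes "reduced w"
  shows "foldr cons_cancel (cons_cancel a v) w = cons_cancel a (foldr cons_cancel v w)"
proof (cases v)
  case (Cons b v')
  then show ?thesis
    using cons_cancel_cancel[OF reduced_foldr[OF assms], of a v'] by auto
qed auto

lemma foldr_assoc:
  "reduced w \<Longrightarrow> foldr cons_cancel (foldr cons_cancel u v) w = foldr cons_cancel u (foldr cons_cancel v w)"
  by (induction u) (auto simp: foldr_cons_cancel)

lemma foldr_Nil: "reduced u \<Longrightarrow> foldr cons_cancel u [] = u"
  by (induction u rule: reduced.induct) auto

lemma foldr_inverse:
  "reduced w \<Longrightarrow> foldr cons_cancel (rev (map inv_letter u)) (foldr cons_cancel u w) = w"
proof (induction u arbitrary: w)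
  case (Cons a u)
  show ?case
    using Cons.IH[OF Cons.prems] cons_cancel_cancel[OF reduced_foldr[OF Cons.prems], of "inv_letter a" u]
    by simp
qed auto

lemma group_free_group: "group (free_group N)"
proof (rule groupI)
  fix u v w assume "u \<in> carrier (free_group N)" "v \<in> carrier (free_group N)" "w \<in> carrier (free_group N)"
  then show "u \<otimes>\<^bsub>free_group N\<^esub> v \<otimes>\<^bsub>free_group N\<^esub> w = u \<otimes>\<^bsub>free_group N\<^esub> (v \<otimes>\<^bsub>free_group N\<^esub> w)"
    by (auto simp: free_group_def foldr_assoc)
next
  fix u v assume "u \<in> carrier (free_group N)" "v \<in> carrier (free_group N)"
  then show "u \<otimes>\<^bsub>free_group N\<^esub> v \<in> carrier (free_group N)"
    using set_foldr[of u v] by (fastforce simp: free_group_def reduced_foldr)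
next
  fix u assume u: "u \<in> carrier (free_group N)"
  let ?v = "foldr cons_cancel (rev (map inv_letter u)) []"
  have "fst ` set ?v \<subseteq> fst ` set u"
    using image_mono[OF set_foldr[of "rev (map inv_letter u)" "[]"], of fst]
    by (simp add: image_image)
  then have "?v \<in> carrier (free_group N)"
    using u by (auto simp: free_group_def reduced_foldr)
  moreover have "?v \<otimes>\<^bsub>free_group N\<^esub> u = \<one>\<^bsub>free_group N\<^esub>"
    using u foldr_assoc[of u "rev (map inv_letter u)" "[]"] foldr_inverse[of "[]" u]
    by (simp add: free_group_def foldr_Nil)
  ultimately show "\<exists>v\<in>carrier (free_group N). v \<otimes>\<^bsub>free_group N\<^esub> u = \<one>\<^bsub>free_group N\<^esub>"
    by blast
qed (auto simp: free_group_def)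

lemma (in group) letter_eval_closed:
  "A \<in> {..<N} \<rightarrow> carrier G \<Longrightarrow> fst a < N \<Longrightarrow> letter_eval G A a \<in> carrier G"
  by (auto simp: letter_eval_def)

lemma (in group) word_eval_closed:
  "A \<in> {..<N} \<rightarrow> carrier G \<Longrightarrow> fst ` set w \<subseteq> {..<N} \<Longrightarrow> word_eval G A w \<in> carrier G"
proof (induction w)
  case (Cons a w)
  then show ?case
    using letter_eval_closed[of A N a] by (auto simp: word_eval_def)
qed (auto simp: word_eval_def)

lemma (in group) word_eval_cons_cancel:
  assumes A: "A \<in> {..<N} \<rightarrow> carrier G" and "fst a < N" "fst ` set w \<subseteq> {..<N}"
  shows "word_eval G A (cons_cancel a w) = letter_eval G A a \<otimes> word_eval G A w"
proof (cases w)
  case (Cons b w')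
  have *: "A (fst a) \<in> carrier G" "word_eval G A w' \<in> carrier G"
    using assms Cons word_eval_closed[OF A, of w'] by auto
  have "letter_eval G A a \<otimes> (letter_eval G A (inv_letter a) \<otimes> word_eval G A w') = word_eval G A w'"
    using * by (simp add: letter_eval_def inv_letter_def m_assoc[symmetric])
  then show ?thesis
    using Cons by (auto simp: word_eval_def)
qed (auto simp: word_eval_def)

lemma (in group) word_eval_hom:
  assumes A: "A \<in> {..<N} \<rightarrow> carrier G"
  shows "word_eval G A \<in> hom (free_group N) G"
proof (rule homI)
  fix u assume "u \<in> carrier (free_group N)"
  then show "word_eval G A u \<in> carrier G"
    by (auto simp: free_group_def intro!: word_eval_closed[OF A])
next
  fix u v assume "u \<in> carrier (free_group N)" "v \<in> carrier (free_group N)"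
  then have u: "fst ` set u \<subseteq> {..<N}" and v: "fst ` set v \<subseteq> {..<N}"
    by (auto simp: free_group_def)
  have "word_eval G A (foldr cons_cancel u v) = word_eval G A u \<otimes> word_eval G A v"
    using u
  proof (induction u)
    case Nil
    show ?case
      using word_eval_closed[OF A v] by (simp add: word_eval_def)
  next
    case (Cons a u)
    then have a: "fst a < N" and u: "fst ` set u \<subseteq> {..<N}"
      by auto
    have "fst ` set (foldr cons_cancel u v) \<subseteq> {..<N}"
      using set_foldr[of u v] u v by fastforce
    from word_eval_cons_cancel[OF A a this] Cons.IH[OF u] show ?case
      using letter_eval_closed[OF A a] word_eval_closed[OF A u] word_eval_closed[OF A v]
      by (simp add: word_eval_def m_assoc)
  qed
  then show "word_eval G A (u \<otimes>\<^bsub>free_group N\<^esub> v) = word_eval G A u \<otimes> word_eval G A v"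
    by (simp add: free_group_def)
qed


section \<open>Character varieties of the free group\<close>

text \<open>
  An affine algebraic group is given as a group \<open>\<Gamma>\<close> together with its coordinate ring \<open>R\<close>, a set of
  functions on \<open>carrier \<Gamma>\<close>. A representation of the free group is identified with the tuple of
  images of the generators, a point of \<open>\<Gamma>\<^sup>N\<close>.
\<close>

definition rep_variety :: "('g, 'x) monoid_scheme \<Rightarrow> nat \<Rightarrow> (nat \<Rightarrow> 'g) set" where
  "rep_variety \<Gamma> N = {..<N} \<rightarrow>\<^sub>E carrier \<Gamma>"

text \<open>
  The coordinate ring of the product variety \<open>\<Gamma>\<^sup>N\<close> is generated by the pullbacks of \<open>R\<close> along the
  \<open>N\<close> projections.
\<close>

definition rep_coord_ring ::
  "('g, 'x) monoid_scheme \<Rightarrow> ('g \<Rightarrow> complex) set \<Rightarrow> nat \<Rightarrow> ((nat \<Rightarrow> 'g) \<Rightarrow> complex) set" where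
  "rep_coord_ring \<Gamma> R N =
     alg_generated (rep_variety \<Gamma> N) {\<lambda>A\<in>rep_variety \<Gamma> N. f (A i) | f i. f \<in> R \<and> i < N}"

definition conjugate :: "('g, 'x) monoid_scheme \<Rightarrow> nat \<Rightarrow> 'g \<Rightarrow> (nat \<Rightarrow> 'g) \<Rightarrow> (nat \<Rightarrow> 'g)" where
  "conjugate \<Gamma> N g A = (\<lambda>i\<in>{..<N}. g \<otimes>\<^bsub>\<Gamma>\<^esub> A i \<otimes>\<^bsub>\<Gamma>\<^esub> inv\<^bsub>\<Gamma>\<^esub> g)"

text \<open>
  The coordinate ring of the categorical quotient \<open>\<Gamma>\<^sup>N // \<Gamma>\<close>: functions on the quotient are identified
  with conjugation-invariant regular functions on \<open>\<Gamma>\<^sup>N\<close>.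
\<close>

definition char_coord_ring ::
  "('g, 'x) monoid_scheme \<Rightarrow> ('g \<Rightarrow> complex) set \<Rightarrow> nat \<Rightarrow> ((nat \<Rightarrow> 'g) \<Rightarrow> complex) set" where
  "char_coord_ring \<Gamma> R N =
     {f \<in> rep_coord_ring \<Gamma> R N. \<forall>g\<in>carrier \<Gamma>. \<forall>A\<in>rep_variety \<Gamma> N. f (conjugate \<Gamma> N g A) = f A}"

abbreviation char_ring :: "('d::finite) cmat set \<Rightarrow> nat \<Rightarrow> ((nat \<Rightarrow> 'd cmat) \<Rightarrow> complex) set" where
  "char_ring G N \<equiv> char_coord_ring (matrix_group G) (matrix_coord_ring G) N"

abbreviation quotient_char_ring ::
  "('d::finite) cmat set \<Rightarrow> 'd cmat set \<Rightarrow> nat \<Rightarrow> ((nat \<Rightarrow> 'd cmat set) \<Rightarrow> complex) set" where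
  "quotient_char_ring G H N \<equiv> char_coord_ring (matrix_group G Mod H) (quotient_coord_ring G H) N"

definition tau :: "('d::finite) cmat set \<Rightarrow> nat \<Rightarrow> letter list \<Rightarrow> (nat \<Rightarrow> 'd cmat) \<Rightarrow> complex" where
  "tau G N g = (\<lambda>A\<in>rep_variety (matrix_group G) N. trace (word_eval (matrix_group G) A g))"


section \<open>Exponent vectors and the generating set\<close>

text \<open>Vectors over the integers mod \<open>m\<close> have entries in \<open>{0..<m}\<close>.\<close>

definition exponent_vector :: "nat \<Rightarrow> nat \<Rightarrow> letter list \<Rightarrow> (nat \<Rightarrow> int)" where
  "exponent_vector m N w =
     (\<lambda>i\<in>{..<N}. (\<Sum>a\<leftarrow>w. if fst a = i then (if snd a then 1 else - 1) else 0) mod int m)"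

definition zero_sum :: "nat \<Rightarrow> nat \<Rightarrow> (nat \<Rightarrow> int) multiset \<Rightarrow> bool" where
  "zero_sum m N M \<longleftrightarrow> (\<forall>i<N. (\<Sum>v\<in>#M. v i) mod int m = 0)"

definition minimal_zero_sums :: "nat \<Rightarrow> nat \<Rightarrow> (nat \<Rightarrow> int) multiset set" where
  "minimal_zero_sums m N =
     {M. M \<noteq> {#} \<and> set_mset M \<subseteq> ({..<N} \<rightarrow>\<^sub>E {0..<int m}) \<and> zero_sum m N M \<and>
         (\<forall>K. K \<subset># M \<and> K \<noteq> {#} \<longrightarrow> \<not> zero_sum m N K)}"

text \<open>
  \<open>psi\<close> is the map \<open>G\<^sup>N \<rightarrow> (G/H)\<^sup>N\<close> inducing the map of character varieties; composition with
  the induced map is composition with \<open>psi\<close> on invariant functions.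
\<close>

definition psi :: "('d::finite) cmat set \<Rightarrow> 'd cmat set \<Rightarrow> nat \<Rightarrow> (nat \<Rightarrow> 'd cmat) \<Rightarrow> (nat \<Rightarrow> 'd cmat set)" where
  "psi G H N A = (\<lambda>i\<in>{..<N}. proj G H (A i))"

text \<open>
  \<open>lambda_fun\<close> is only meaningful when the exponent vectors of \<open>gs\<close> add up to zero modulo the order of
  the scalar group \<open>H\<close>; then the described function exists, and it is unique because \<open>psi\<close> is onto.
\<close>

definition lambda_fun ::
  "('d::finite) cmat set \<Rightarrow> 'd cmat set \<Rightarrow> nat \<Rightarrow> letter list list \<Rightarrow> (nat \<Rightarrow> 'd cmat set) \<Rightarrow> complex" where
  "lambda_fun G H N gs =
     (THE f. f \<in> quotient_char_ring G H N \<and>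
        (\<forall>A\<in>rep_variety (matrix_group G) N. f (psi G H N A) = (\<Prod>g\<leftarrow>gs. tau G N g A)))"

definition lambda_set ::
  "('d::finite) cmat set \<Rightarrow> 'd cmat set \<Rightarrow> nat \<Rightarrow> nat \<Rightarrow> letter list set \<Rightarrow> ((nat \<Rightarrow> 'd cmat set) \<Rightarrow> complex) set" where
  "lambda_set G H m N B =
     {lambda_fun G H N gs | gs.
        set gs \<subseteq> B \<and> mset (map (exponent_vector m N) gs) \<in> minimal_zero_sums m N}"

end

theory Submission
  imports Defs "HOL-Algebra.Product_Groups" "HOL-Algebra.Multiplicative_Group"
begin

text \<open>
  Let \<open>\<mu>\<close> be the group of scalars occurring in \<open>H\<close>; being a group of \<open>m\<close> complex numbers, it consists of all
  \<open>m\<close>-th roots of unity (\<open>scalars_eq\<close>). The finite group \<open>\<mu>\<^sup>N\<close> acts on \<open>G\<^sup>N\<close> by multiplying the \<open>i\<close>-th matrix by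
  the \<open>i\<close>-th scalar, and \<open>psi\<close> identifies the orbits with the points of \<open>(G/H)\<^sup>N\<close>. Functions on \<open>(G/H)\<^sup>N\<close> are
  thus the same as \<open>\<mu>\<^sup>N\<close>-invariant functions on \<open>G\<^sup>N\<close>, and the theorem is a computation of invariants.

  The algebras in question are generated by functions on which \<open>\<mu>\<^sup>N\<close> acts through characters: a matrix entry
  of the \<open>k\<close>-th matrix is multiplied by \<open>t\<^sub>k\<close>, the inverse of its determinant by a power of \<open>1/t\<^sub>k\<close>, and \<open>\<tau>\<^sub>g\<close> by
  the product over \<open>i\<close> of the powers of \<open>t\<^sub>i\<close> whose exponents are the exponent sums of the generators in \<open>g\<close>. Averaging over the group shows that an
  invariant element of such an algebra is a linear combination of monomials with trivial character
  (\<open>invariant_monomials\<close>).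

  For the matrix coordinates, such a monomial is a product of \<open>\<mu>\<close>-invariant functions in the separate matrices,
  so it descends to \<open>(G/H)\<^sup>N\<close>. Therefore every invariant regular function descends to a regular one
  (\<open>regular_invariant_descends\<close>), which gives the existence of the functions \<open>\<lambda>\<close>.

  For the trace functions \<open>\<tau>\<^sub>g\<close> with \<open>g \<in> B\<close>, a monomial has trivial character iff the exponent vectors of its
  factors add up to zero mod \<open>m\<close> (\<open>trivial_weight_iff_zero_sum\<close>). A multiset of vectors with sum zero is a
  union of minimal ones, so the monomial is a product of pullbacks of functions \<open>\<lambda>\<close> from the generating set
  (\<open>zero_sum_product_descends\<close>). Applied to the pullback of a function in \<open>\<complex>[X\<^bsub>G/H\<^esub>(F\<^sub>N)]\<close>, which is a polynomial
  in the \<open>\<tau>\<^sub>g\<close> by hypothesis, this expresses the function as a polynomial in the \<open>\<lambda>\<close>.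
\<close>

section \<open>Finite products and sums indexed by lists\<close>

lemma sum_list_mult_sum_list:
  fixes f :: "'a \<Rightarrow> 'c::comm_ring_1"
  shows "(\<Sum>x\<leftarrow>xs. f x) * (\<Sum>y\<leftarrow>ys. g y) = (\<Sum>(x, y)\<leftarrow>List.product xs ys. f x * g y)"
  by (induction xs) (simp_all add: algebra_simps sum_list_const_mult comp_def)

lemma prod_list_mult_distrib:
  fixes f g :: "'a \<Rightarrow> 'c::comm_monoid_mult"
  shows "(\<Prod>x\<leftarrow>xs. f x * g x) = (\<Prod>x\<leftarrow>xs. f x) * (\<Prod>x\<leftarrow>xs. g x)"
  by (induction xs) (simp_all add: ac_simps)

lemma prod_list_filter:
  fixes f :: "'a \<Rightarrow> 'c::comm_monoid_mult"
  assumes "\<And>x. x \<in> set xs \<Longrightarrow> \<not> P x \<Longrightarrow> f x = 1"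
  shows "(\<Prod>x\<leftarrow>filter P xs. f x) = (\<Prod>x\<leftarrow>xs. f x)"
  using assms by (induction xs) auto

lemma prod_list_powi:
  fixes c :: complex
  shows "c \<noteq> 0 \<Longrightarrow> (\<Prod>x\<leftarrow>xs. c powi f x) = c powi (\<Sum>x\<leftarrow>xs. f x)"
  by (induction xs) (simp_all add: power_int_add)

lemma prod_list_group:
  fixes f :: "'a \<Rightarrow> 'c::comm_monoid_mult"
  assumes "finite K" "k ` set xs \<subseteq> K"
  shows "(\<Prod>x\<leftarrow>xs. f x) = (\<Prod>j\<in>K. \<Prod>x\<leftarrow>filter (\<lambda>x. k x = j) xs. f x)"
  using assms(2)
proof (induction xs)
  case (Cons x xs)
  have "(\<Prod>j\<in>K. \<Prod>y\<leftarrow>filter (\<lambda>x. k x = j) (x # xs). f y) =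
        (\<Prod>j\<in>K. (if k x = j then f x else 1) * (\<Prod>y\<leftarrow>filter (\<lambda>x. k x = j) xs. f y))"
    by (intro prod.cong) auto
  also have "\<dots> = f x * (\<Prod>j\<in>K. \<Prod>y\<leftarrow>filter (\<lambda>x. k x = j) xs. f y)"
    using Cons.prems assms(1) by (simp add: prod.distrib)
  finally show ?case
    using Cons by simp
qed simp

section \<open>Generated algebras of functions\<close>

lemma alg_generated_extensional:
  assumes "S \<subseteq> extensional X" "f \<in> alg_generated X S"
  shows "f \<in> extensional X"
  using assms(2,1) by induction auto

text \<open>
  It suffices to pull back generators because pulling back along a map is a homomorphism of algebras.
  With \<open>\<phi>\<close> the identity this is also how a set of generators is replaced by another one.
\<close>

lemma alg_generated_pullback:
  assumes "f \<in> alg_generated Y S" and \<phi>: "\<phi> \<in> X \<rightarrow> Y"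
    and S: "\<And>s. s \<in> S \<Longrightarrow> (\<lambda>x\<in>X. s (\<phi> x)) \<in> alg_generated X S'"
  shows "(\<lambda>x\<in>X. f (\<phi> x)) \<in> alg_generated X S'"
  using assms(1)
proof induction
  case (const c)
  have "(\<lambda>x\<in>X. (\<lambda>y\<in>Y. c) (\<phi> x)) = (\<lambda>x\<in>X. c)"
    using \<phi> by (intro restrict_ext) auto
  then show ?case
    by (simp only: alg_generated.const)
next
  case (add f g)
  have "(\<lambda>x\<in>X. (\<lambda>y\<in>Y. f y + g y) (\<phi> x)) = (\<lambda>x\<in>X. (\<lambda>x\<in>X. f (\<phi> x)) x + (\<lambda>x\<in>X. g (\<phi> x)) x)"
    using \<phi> by (intro restrict_ext) auto
  then show ?case
    using alg_generated.add[OF add.IH] by (simp only:)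
next
  case (mult f g)
  have "(\<lambda>x\<in>X. (\<lambda>y\<in>Y. f y * g y) (\<phi> x)) = (\<lambda>x\<in>X. (\<lambda>x\<in>X. f (\<phi> x)) x * (\<lambda>x\<in>X. g (\<phi> x)) x)"
    using \<phi> by (intro restrict_ext) auto
  then show ?case
    using alg_generated.mult[OF mult.IH] by (simp only:)
qed (rule S)

lemma alg_generated_scale:
  assumes "f \<in> alg_generated X S"
  shows "(\<lambda>x\<in>X. c * f x) \<in> alg_generated X S"
proof -
  have "(\<lambda>x\<in>X. c * f x) = (\<lambda>x\<in>X. (\<lambda>x\<in>X. c) x * f x)"
    by (intro restrict_ext) simp
  then show ?thesis
    using alg_generated.mult[OF alg_generated.const assms] by (simp only:)
qed

lemma alg_generated_sum_list:
  assumes "\<And>l. l \<in> set ls \<Longrightarrow> F l \<in> alg_generated X S"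
  shows "(\<lambda>x\<in>X. \<Sum>l\<leftarrow>ls. F l x) \<in> alg_generated X S"
  using assms
proof (induction ls)
  case Nil
  show ?case by (simp only: list.map sum_list.Nil alg_generated.const)
next
  case (Cons l ls)
  have "(\<lambda>x\<in>X. \<Sum>l\<leftarrow>l # ls. F l x) = (\<lambda>x\<in>X. F l x + (\<lambda>x\<in>X. \<Sum>l\<leftarrow>ls. F l x) x)"
    by (intro restrict_ext) simp
  then show ?case
    using alg_generated.add[of "F l" X S] Cons by (simp only: list.set_intros)
qed

lemma alg_generated_prod:
  assumes "finite I" "\<And>i. i \<in> I \<Longrightarrow> F i \<in> alg_generated X S"
  shows "(\<lambda>x\<in>X. \<Prod>i\<in>I. F i x) \<in> alg_generated X S"
  using assms
proof (induction I)
  case empty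
  show ?case by (simp only: prod.empty alg_generated.const)
next
  case (insert i I)
  have "(\<lambda>x\<in>X. \<Prod>i\<in>insert i I. F i x) = (\<lambda>x\<in>X. F i x * (\<lambda>x\<in>X. \<Prod>i\<in>I. F i x) x)"
    using insert.hyps by (intro restrict_ext) simp
  then show ?case
    using alg_generated.mult[of "F i" X S] insert by (simp only: insertI1 insertI2)
qed

lemma alg_generated_prod_list:
  assumes "\<And>l. l \<in> set ls \<Longrightarrow> F l \<in> alg_generated X S"
  shows "(\<lambda>x\<in>X. \<Prod>l\<leftarrow>ls. F l x) \<in> alg_generated X S"
  using assms
proof (induction ls)
  case Nil
  show ?case by (simp only: list.map prod_list.Nil alg_generated.const)
next
  case (Cons l ls)
  have "(\<lambda>x\<in>X. \<Prod>l\<leftarrow>l # ls. F l x) = (\<lambda>x\<in>X. F l x * (\<lambda>x\<in>X. \<Prod>l\<leftarrow>ls. F l x) x)"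
    by (intro restrict_ext) simp
  then show ?case
    using alg_generated.mult[of "F l" X S] Cons by (simp only: list.set_intros)
qed

text \<open>
  The normal form on which everything else rests. Monomials are given by lists of indices and not of
  functions: a generator that happens to be the zero function does not determine the character
  by which a group acts on it, so characters are attached to indices.
\<close>

lemma alg_generated_monomials:
  assumes "p \<in> alg_generated X (\<sigma> ` I)"
  shows "\<exists>L. (\<forall>(c, is)\<in>set L. set is \<subseteq> I) \<and>
             (\<forall>x\<in>X. p x = (\<Sum>(c, is)\<leftarrow>L. c * (\<Prod>i\<leftarrow>is. \<sigma> i x)))"
  using assms
proof induction
  case (const c)
  show ?case
    by (rule exI[of _ "[(c, [])]"]) auto
next
  case (gen f)
  then obtain i where "i \<in> I" "f = \<sigma> i"
    by blast
  then show ?case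
    by (intro exI[of _ "[(1, [i])]"]) auto
next
  case (add f g)
  then obtain L M where "\<forall>(c, is)\<in>set L. set is \<subseteq> I" "\<forall>(c, is)\<in>set M. set is \<subseteq> I"
    and "\<forall>x\<in>X. f x = (\<Sum>(c, is)\<leftarrow>L. c * (\<Prod>i\<leftarrow>is. \<sigma> i x))"
    and "\<forall>x\<in>X. g x = (\<Sum>(c, is)\<leftarrow>M. c * (\<Prod>i\<leftarrow>is. \<sigma> i x))"
    by blast
  then show ?case
    by (intro exI[of _ "L @ M"]) auto
next
  case (mult f g)
  then obtain L M where LM: "\<forall>(c, is)\<in>set L. set is \<subseteq> I" "\<forall>(c, is)\<in>set M. set is \<subseteq> I"
    and f: "\<forall>x\<in>X. f x = (\<Sum>(c, is)\<leftarrow>L. c * (\<Prod>i\<leftarrow>is. \<sigma> i x))"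
    and g: "\<forall>x\<in>X. g x = (\<Sum>(c, is)\<leftarrow>M. c * (\<Prod>i\<leftarrow>is. \<sigma> i x))"
    by blast
  let ?LM = "map (\<lambda>((c, is), (d, js)). (c * d, is @ js)) (List.product L M)"
  have "f x * g x = (\<Sum>(c, is)\<leftarrow>?LM. c * (\<Prod>i\<leftarrow>is. \<sigma> i x))" if "x \<in> X" for x
    using f g that by (simp add: sum_list_mult_sum_list comp_def case_prod_unfold ac_simps)
  moreover have "\<forall>(c, is)\<in>set ?LM. set is \<subseteq> I"
    using LM by fastforce
  ultimately show ?case
    by (intro exI[of _ ?LM]) auto
qed

section \<open>Invariants of a finite group acting through characters\<close>

text \<open>
  Translating the summation variable by \<open>s\<close> multiplies the sum by \<open>\<eta> s\<close>.
\<close>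

lemma sum_nontrivial_character:
  fixes \<eta> :: "'t \<Rightarrow> complex"
  assumes "group T" and hom: "\<And>s t. s \<in> carrier T \<Longrightarrow> t \<in> carrier T \<Longrightarrow> \<eta> (s \<otimes>\<^bsub>T\<^esub> t) = \<eta> s * \<eta> t"
    and "s \<in> carrier T" "\<eta> s \<noteq> 1"
  shows "(\<Sum>t\<in>carrier T. \<eta> t) = 0"
proof -
  interpret group T by fact
  have "bij_betw (\<lambda>t. s \<otimes>\<^bsub>T\<^esub> t) (carrier T) (carrier T)"
    using assms(3) by (intro bij_betwI[where g = "\<lambda>t. inv\<^bsub>T\<^esub> s \<otimes>\<^bsub>T\<^esub> t"]) (auto simp: m_assoc[symmetric])
  then have "(\<Sum>t\<in>carrier T. \<eta> t) = (\<Sum>t\<in>carrier T. \<eta> (s \<otimes>\<^bsub>T\<^esub> t))"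
    by (rule sum.reindex_bij_betw[symmetric])
  also have "\<dots> = \<eta> s * (\<Sum>t\<in>carrier T. \<eta> t)"
    using assms(3) by (simp add: hom sum_distrib_left)
  finally show ?thesis
    using \<open>\<eta> s \<noteq> 1\<close> by (metis mult_cancel_right1)
qed

text \<open>
  A monomial in functions that transform by characters transforms by the product of their characters.
  Averaging over the group fixes the invariant function \<open>p\<close>, keeps the monomials with trivial
  character and kills all others by orthogonality. So in any expression of \<open>p\<close> as a linear combination
  of monomials, those with nontrivial character may be dropped.
\<close>

lemma invariant_monomials:
  fixes T :: "('t, 'z) monoid_scheme" and \<sigma> :: "'i \<Rightarrow> 'x \<Rightarrow> complex"
  assumes T: "group T" "finite (carrier T)"
    and act: "\<And>t x. t \<in> carrier T \<Longrightarrow> x \<in> X \<Longrightarrow> act t x \<in> X"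
    and \<eta>: "\<And>i s t. i \<in> I \<Longrightarrow> s \<in> carrier T \<Longrightarrow> t \<in> carrier T \<Longrightarrow> \<eta> i (s \<otimes>\<^bsub>T\<^esub> t) = \<eta> i s * \<eta> i t"
    and \<sigma>: "\<And>i t x. i \<in> I \<Longrightarrow> t \<in> carrier T \<Longrightarrow> x \<in> X \<Longrightarrow> \<sigma> i (act t x) = \<eta> i t * \<sigma> i x"
    and p: "p \<in> alg_generated X (\<sigma> ` I)"
    and inv: "\<And>t x. t \<in> carrier T \<Longrightarrow> x \<in> X \<Longrightarrow> p (act t x) = p x"
  shows "\<exists>L. (\<forall>(c, is)\<in>set L. set is \<subseteq> I \<and> (\<forall>t\<in>carrier T. (\<Prod>i\<leftarrow>is. \<eta> i t) = 1)) \<and>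
             (\<forall>x\<in>X. p x = (\<Sum>(c, is)\<leftarrow>L. c * (\<Prod>i\<leftarrow>is. \<sigma> i x)))"
proof -
  interpret group T by fact
  obtain L where L: "\<forall>(c, is)\<in>set L. set is \<subseteq> I"
    and p_eq: "\<forall>x\<in>X. p x = (\<Sum>(c, is)\<leftarrow>L. c * (\<Prod>i\<leftarrow>is. \<sigma> i x))"
    using alg_generated_monomials[OF p] by blast
  define triv where "triv is \<longleftrightarrow> (\<forall>t\<in>carrier T. (\<Prod>i\<leftarrow>is. \<eta> i t) = 1)" for "is"
  define n where "n = (of_nat (card (carrier T)) :: complex)"
  have n: "n \<noteq> 0"
    using T(2) one_closed by (auto simp: n_def)
  have hom: "(\<Prod>i\<leftarrow>is. \<eta> i (s \<otimes>\<^bsub>T\<^esub> t)) = (\<Prod>i\<leftarrow>is. \<eta> i s) * (\<Prod>i\<leftarrow>is. \<eta> i t)"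
    if "set is \<subseteq> I" "s \<in> carrier T" "t \<in> carrier T" for "is" s t
  proof -
    have "(\<Prod>i\<leftarrow>is. \<eta> i (s \<otimes>\<^bsub>T\<^esub> t)) = (\<Prod>i\<leftarrow>is. \<eta> i s * \<eta> i t)"
      using that by (intro arg_cong[where f = prod_list] map_cong) (auto simp: \<eta>)
    then show ?thesis
      by (simp add: prod_list_mult_distrib)
  qed
  have semi: "(\<Prod>i\<leftarrow>is. \<sigma> i (act t x)) = (\<Prod>i\<leftarrow>is. \<eta> i t) * (\<Prod>i\<leftarrow>is. \<sigma> i x)"
    if "set is \<subseteq> I" "t \<in> carrier T" "x \<in> X" for "is" t x
  proof -
    have "(\<Prod>i\<leftarrow>is. \<sigma> i (act t x)) = (\<Prod>i\<leftarrow>is. \<eta> i t * \<sigma> i x)"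
      using that by (intro arg_cong[where f = prod_list] map_cong) (auto simp: \<sigma>)
    then show ?thesis
      by (simp add: prod_list_mult_distrib)
  qed
  have char_sum: "(\<Sum>t\<in>carrier T. \<Prod>i\<leftarrow>is. \<eta> i t) = (if triv is then n else 0)" if "set is \<subseteq> I" for "is"
    using sum_nontrivial_character[OF T(1), of "\<lambda>t. \<Prod>i\<leftarrow>is. \<eta> i t"] hom[OF that]
    by (auto simp: triv_def n_def)
  have average: "p x = (\<Sum>(c, is)\<leftarrow>filter (triv \<circ> snd) L. c * (\<Prod>i\<leftarrow>is. \<sigma> i x))" if x: "x \<in> X" for x
  proof -
    have "n * p x = (\<Sum>t\<in>carrier T. p (act t x))"
      using inv x by (simp add: n_def)
    also have "\<dots> = (\<Sum>t\<in>carrier T. \<Sum>(c, is)\<leftarrow>L. c * (\<Prod>i\<leftarrow>is. \<sigma> i (act t x)))"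
      using p_eq act x by simp
    also have "\<dots> = (\<Sum>(c, is)\<leftarrow>L. \<Sum>t\<in>carrier T. c * (\<Prod>i\<leftarrow>is. \<sigma> i (act t x)))"
      by (induction L) (auto simp: sum.distrib case_prod_beta)
    also have "\<dots> = (\<Sum>(c, is)\<leftarrow>L. n * (if triv is then c * (\<Prod>i\<leftarrow>is. \<sigma> i x) else 0))"
    proof (intro arg_cong[where f = sum_list] map_cong refl, clarsimp, intro conjI impI)
      fix c "is" assume "(c, is) \<in> set L"
      then have "is": "set is \<subseteq> I"
        using L by auto
      have "(\<Sum>t\<in>carrier T. c * (\<Prod>i\<leftarrow>is. \<sigma> i (act t x))) =
            c * (\<Sum>t\<in>carrier T. \<Prod>i\<leftarrow>is. \<eta> i t) * (\<Prod>i\<leftarrow>is. \<sigma> i x)"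
        using x by (simp add: semi[OF "is"] sum_distrib_left sum_distrib_right mult.assoc)
      then have *: "(\<Sum>t\<in>carrier T. c * (\<Prod>i\<leftarrow>is. \<sigma> i (act t x))) =
            c * (if triv is then n else 0) * (\<Prod>i\<leftarrow>is. \<sigma> i x)"
        by (simp only: char_sum[OF "is"])
      show "(\<Sum>t\<in>carrier T. c * (\<Prod>i\<leftarrow>is. \<sigma> i (act t x))) = n * (c * (\<Prod>i\<leftarrow>is. \<sigma> i x))" if "triv is"
        using * that by simp
      show "(\<Sum>t\<in>carrier T. c * (\<Prod>i\<leftarrow>is. \<sigma> i (act t x))) = 0" if "\<not> triv is"
        using * that by simp
    qed
    also have "\<dots> = n * (\<Sum>(c, is)\<leftarrow>filter (triv \<circ> snd) L. c * (\<Prod>i\<leftarrow>is. \<sigma> i x))"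
      by (induction L) (auto simp: algebra_simps)
    finally show ?thesis
      using n by simp
  qed
  show ?thesis
    using L average by (intro exI[of _ "filter (triv \<circ> snd) L"]) (auto simp: triv_def)
qed

text \<open>
  By linearity, an invariant function factors through \<open>\<phi>\<close> as soon as the monomials of trivial character
  do. This is used twice below, once with the matrix coordinates as generators and once with the trace
  functions.
\<close>

lemma invariant_descends:
  fixes T :: "('t, 'z) monoid_scheme" and \<sigma> :: "'i \<Rightarrow> 'x \<Rightarrow> complex"
  assumes "group T" "finite (carrier T)"
    and "\<And>t x. t \<in> carrier T \<Longrightarrow> x \<in> X \<Longrightarrow> act t x \<in> X"
    and "\<And>i s t. i \<in> I \<Longrightarrow> s \<in> carrier T \<Longrightarrow> t \<in> carrier T \<Longrightarrow> \<eta> i (s \<otimes>\<^bsub>T\<^esub> t) = \<eta> i s * \<eta> i t"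
    and "\<And>i t x. i \<in> I \<Longrightarrow> t \<in> carrier T \<Longrightarrow> x \<in> X \<Longrightarrow> \<sigma> i (act t x) = \<eta> i t * \<sigma> i x"
    and "p \<in> alg_generated X (\<sigma> ` I)"
    and "\<And>t x. t \<in> carrier T \<Longrightarrow> x \<in> X \<Longrightarrow> p (act t x) = p x"
    and \<phi>: "\<phi> \<in> X \<rightarrow> Y"
    and descends: "\<And>is. set is \<subseteq> I \<Longrightarrow> \<forall>t\<in>carrier T. (\<Prod>i\<leftarrow>is. \<eta> i t) = 1 \<Longrightarrow>
                    \<exists>q\<in>alg_generated Y S. \<forall>x\<in>X. q (\<phi> x) = (\<Prod>i\<leftarrow>is. \<sigma> i x)"
  shows "\<exists>q\<in>alg_generated Y S. \<forall>x\<in>X. q (\<phi> x) = p x"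
proof -
  obtain L where L: "\<forall>(c, is)\<in>set L. set is \<subseteq> I \<and> (\<forall>t\<in>carrier T. (\<Prod>i\<leftarrow>is. \<eta> i t) = 1)"
    and p: "\<forall>x\<in>X. p x = (\<Sum>(c, is)\<leftarrow>L. c * (\<Prod>i\<leftarrow>is. \<sigma> i x))"
    using invariant_monomials[of T X act I \<eta> \<sigma> p] assms(1-7) by blast
  have "\<forall>l\<in>set L. \<exists>q. q \<in> alg_generated Y S \<and> (\<forall>x\<in>X. q (\<phi> x) = (\<Prod>i\<leftarrow>snd l. \<sigma> i x))"
    using L descends by fastforce
  then obtain q where q: "\<And>l. l \<in> set L \<Longrightarrow> q l \<in> alg_generated Y S"
    "\<And>l x. l \<in> set L \<Longrightarrow> x \<in> X \<Longrightarrow> q l (\<phi> x) = (\<Prod>i\<leftarrow>snd l. \<sigma> i x)"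
    by metis
  show ?thesis
  proof (intro bexI ballI)
    show "(\<lambda>y\<in>Y. \<Sum>l\<leftarrow>L. (\<lambda>y\<in>Y. fst l * q l y) y) \<in> alg_generated Y S"
      by (intro alg_generated_sum_list alg_generated_scale q)
    fix x assume x: "x \<in> X"
    then have "\<phi> x \<in> Y"
      using \<phi> by blast
    then show "(\<lambda>y\<in>Y. \<Sum>l\<leftarrow>L. (\<lambda>y\<in>Y. fst l * q l y) y) (\<phi> x) = p x"
      using p x q(2) by (auto simp: case_prod_beta intro!: arg_cong[where f = sum_list])
  qed
qed

section \<open>Scalar matrices\<close>

lemma scalar_mult_nth: "((mat c :: 'd::finite cmat) ** A) $ i $ j = c * A $ i $ j"
  by (simp add: matrix_matrix_mult_def mat_def if_distrib[of "\<lambda>x. x * _"] cong: if_cong)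

lemma scalar_commute: "(mat c :: 'd::finite cmat) ** A = A ** mat c"
proof -
  have "(A ** mat c) $ i $ j = c * A $ i $ j" for i j
    by (simp add: matrix_matrix_mult_def mat_def if_distrib[of "\<lambda>x. _ * x"] cong: if_cong)
  then show ?thesis
    by (simp add: vec_eq_iff scalar_mult_nth)
qed

lemma mat_mult_mat: "(mat a :: 'd::finite cmat) ** mat b = mat (a * b)"
  by (simp add: vec_eq_iff scalar_mult_nth) (simp add: mat_def)

lemma mat_eq_iff: "(mat a :: 'd::finite cmat) = mat b \<longleftrightarrow> a = b"
  by (auto simp: mat_def vec_eq_iff)

lemma det_mat: "det (mat c :: 'd::finite cmat) = c ^ CARD('d)"
  by (subst det_diagonal) (auto simp: mat_def)

lemma trace_scalar_mult: "trace ((mat c :: 'd::finite cmat) ** A) = c * trace A"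
  by (simp add: trace_def scalar_mult_nth sum_distrib_left)

lemma matrix_group_simps [simp]:
  "carrier (matrix_group S) = S" "mult (matrix_group S) = (**)" "one (matrix_group S) = mat 1"
  by (simp_all add: matrix_group_def)

lemma char_ring_invariant:
  "p \<in> char_coord_ring \<Gamma> R N \<Longrightarrow> g \<in> carrier \<Gamma> \<Longrightarrow> A \<in> rep_variety \<Gamma> N \<Longrightarrow> p (conjugate \<Gamma> N g A) = p A"
  by (simp add: char_coord_ring_def)

lemma group_GL: "group (GL :: 'd::finite cmat monoid)"
  unfolding GL_def
proof (rule groupI)
  let ?GL = "matrix_group {A :: 'd cmat. invertible A}"
  show "A \<otimes>\<^bsub>?GL\<^esub> B \<in> carrier ?GL" if "A \<in> carrier ?GL" "B \<in> carrier ?GL" for A B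
    using that invertible_mult[of A B] by simp
  show "A \<otimes>\<^bsub>?GL\<^esub> B \<otimes>\<^bsub>?GL\<^esub> C = A \<otimes>\<^bsub>?GL\<^esub> (B \<otimes>\<^bsub>?GL\<^esub> C)" for A B C
    by (simp add: matrix_mul_assoc)
  show "\<one>\<^bsub>?GL\<^esub> \<in> carrier ?GL"
    by (simp add: invertible_det_nz)
  show "\<exists>B\<in>carrier ?GL. B \<otimes>\<^bsub>?GL\<^esub> A = \<one>\<^bsub>?GL\<^esub>" if "A \<in> carrier ?GL" for A
    using that unfolding invertible_def by auto
qed simp

section \<open>The group of scalars and the quotient group\<close>

locale scalar_quotient =
  fixes G H :: "'d::finite cmat set" and m N :: nat
  assumes subgroup_G: "subgroup G GL"
    and subgroup_H: "subgroup H (matrix_group G)"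
    and order_H: "order (matrix_group H) = m"
    and m_pos: "m > 0"
    and scalar_H: "h \<in> H \<Longrightarrow> \<exists>c. h = mat c"
begin

abbreviation "Q \<equiv> matrix_group G Mod H"
abbreviation "X \<equiv> rep_variety (matrix_group G) N"
abbreviation "Y \<equiv> rep_variety Q N"

sublocale G: group "matrix_group G"
  using subgroup.subgroup_is_group[OF subgroup_G group_GL] by (simp add: GL_def matrix_group_def)

sublocale N: normal H "matrix_group G"
proof (unfold G.normal_inv_iff, intro conjI ballI subgroup_H)
  fix A h assume A: "A \<in> carrier (matrix_group G)" and h: "h \<in> H"
  obtain c where c: "h = mat c"
    using scalar_H[OF h] by blast
  have "A \<otimes>\<^bsub>matrix_group G\<^esub> h \<otimes>\<^bsub>matrix_group G\<^esub> inv\<^bsub>matrix_group G\<^esub> A =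
        h ** (A \<otimes>\<^bsub>matrix_group G\<^esub> inv\<^bsub>matrix_group G\<^esub> A)"
    by (simp add: c scalar_commute[of c A, symmetric] matrix_mul_assoc)
  then show "A \<otimes>\<^bsub>matrix_group G\<^esub> h \<otimes>\<^bsub>matrix_group G\<^esub> inv\<^bsub>matrix_group G\<^esub> A \<in> H"
    using A h by (simp only: G.r_inv) simp
qed

text \<open>
  The scalars occurring in \<open>H\<close>, so that the weights below are ordinary complex numbers.
\<close>

definition scalars :: "complex set" where
  "scalars = {c. mat c \<in> H}"

definition scalar_group :: "complex monoid" where
  "scalar_group = \<lparr>carrier = scalars, mult = (*), one = 1\<rparr>"

lemma H_subset: "H \<subseteq> G"
  using subgroup.subset[OF subgroup_H] by simp

lemma mult_in_G: "A \<in> G \<Longrightarrow> B \<in> G \<Longrightarrow> A ** B \<in> G"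
  using G.m_closed[of A B] by simp

lemma scalars_in_G: "c \<in> scalars \<Longrightarrow> mat c \<in> G"
  using H_subset by (auto simp: scalars_def)

lemma scalars_nonzero: "c \<in> scalars \<Longrightarrow> c \<noteq> 0"
proof -
  assume "c \<in> scalars"
  then have "mat c \<in> G"
    by (rule scalars_in_G)
  then have "det (mat c :: 'd cmat) \<noteq> 0"
    using subgroup.subset[OF subgroup_G] by (auto simp: GL_def invertible_det_nz)
  then show "c \<noteq> 0"
    by (auto simp: det_mat)
qed

lemma mem_H_iff: "h \<in> H \<longleftrightarrow> (\<exists>c\<in>scalars. h = mat c)"
  using scalar_H by (auto simp: scalars_def)

lemma one_scalars [simp]: "1 \<in> scalars"
  using subgroup.one_closed[OF subgroup_H] by (simp add: scalars_def)

lemma mult_scalars [simp]: "a \<in> scalars \<Longrightarrow> b \<in> scalars \<Longrightarrow> a * b \<in> scalars"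
  using subgroup.m_closed[OF subgroup_H, of "mat a" "mat b"] by (simp add: scalars_def mat_mult_mat)

lemma inv_scalar:
  assumes "c \<in> scalars"
  shows "inv\<^bsub>matrix_group G\<^esub> (mat c) = mat (inverse c)" and "inverse c \<in> scalars"
proof -
  have "inv\<^bsub>matrix_group G\<^esub> (mat c) \<in> H"
    using subgroup.m_inv_closed[OF subgroup_H, of "mat c"] assms by (simp add: scalars_def)
  then obtain b where b: "inv\<^bsub>matrix_group G\<^esub> (mat c) = mat b" "b \<in> scalars"
    by (auto simp: mem_H_iff)
  have "mat c \<otimes>\<^bsub>matrix_group G\<^esub> inv\<^bsub>matrix_group G\<^esub> (mat c) = mat 1"
    using G.r_inv[of "mat c"] scalars_in_G[OF assms] by simp
  then have "c * b = 1"
    by (simp add: b mat_mult_mat mat_eq_iff)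
  then have "b = inverse c"
    by (metis inverse_unique)
  then show "inv\<^bsub>matrix_group G\<^esub> (mat c) = mat (inverse c)" "inverse c \<in> scalars"
    using b by auto
qed

lemma group_scalar_group: "group scalar_group"
proof (rule groupI)
  fix c assume "c \<in> carrier scalar_group"
  then show "\<exists>b\<in>carrier scalar_group. b \<otimes>\<^bsub>scalar_group\<^esub> c = \<one>\<^bsub>scalar_group\<^esub>"
    using inv_scalar(2)[of c] scalars_nonzero[of c]
    by (intro bexI[of _ "inverse c"]) (auto simp: scalar_group_def)
qed (auto simp: scalar_group_def)

lemma card_scalars: "card scalars = m"
proof -
  have "card H = card scalars"
    by (intro bij_betw_same_card[symmetric, of mat] bij_betwI') (auto simp: mat_eq_iff mem_H_iff)
  then show ?thesis
    using order_H by (simp add: order_def)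
qed

lemma finite_scalars: "finite scalars"
  using card_scalars m_pos by (simp add: card_ge_0_finite)

text \<open>
  By Lagrange the elements of a group of order \<open>m\<close> are among the \<open>m\<close>-th roots of unity, of which there
  are only \<open>m\<close>.
\<close>

lemma scalars_eq: "scalars = {c. c ^ m = 1}"
proof (rule card_subset_eq)
  interpret S: group scalar_group
    by (rule group_scalar_group)
  have pow: "c [^]\<^bsub>scalar_group\<^esub> k = c ^ k" for c and k :: nat
    by (induction k) (simp_all add: scalar_group_def)
  show "scalars \<subseteq> {c. c ^ m = 1}"
    using S.pow_order_eq_1 unfolding pow by (auto simp: order_def scalar_group_def card_scalars)
  show "finite {c :: complex. c ^ m = 1}"
    using m_pos by (intro finite_roots_unity) simp
  show "card scalars = card {c :: complex. c ^ m = 1}"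
    using m_pos by (simp add: card_scalars card_roots_unity_eq)
qed

text \<open>
  If all \<open>m\<close>-th roots of unity were killed by the exponent \<open>r = e mod m > 0\<close>, they would all be among the
  \<open>r < m\<close> many \<open>r\<close>-th roots of unity.
\<close>

lemma trivial_power_iff:
  "(\<forall>c\<in>scalars. c powi e = 1) \<longleftrightarrow> int m dvd e"
proof
  assume triv: "\<forall>c\<in>scalars. c powi e = 1"
  define r where "r = nat (e mod int m)"
  have r: "int r = e mod int m" "r < m"
    using m_pos by (auto simp: r_def nat_less_iff)
  have pow_r: "c ^ r = 1" if "c \<in> scalars" for c
  proof -
    have c: "c ^ m = 1" "c \<noteq> 0"
      using that scalars_nonzero by (auto simp: scalars_eq)
    have "c powi e = c powi (int m * (e div int m) + int r)"
      using r by simp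
    also have "\<dots> = (c powi int m) powi (e div int m) * c powi int r"
      using c by (simp only: power_int_add power_int_mult simp_thms)
    also have "\<dots> = c ^ r"
      using c by simp
    finally show ?thesis
      using triv that by simp
  qed
  have "r = 0"
  proof (rule ccontr)
    assume "r \<noteq> 0"
    then have "card scalars \<le> card {c :: complex. c ^ r = 1}"
      using pow_r by (intro card_mono finite_roots_unity) auto
    then show False
      using \<open>r \<noteq> 0\<close> r by (simp add: card_scalars card_roots_unity_eq)
  qed
  then show "int m dvd e"
    using r by auto
next
  assume "int m dvd e"
  then obtain k where "e = int m * k" ..
  then show "\<forall>c\<in>scalars. c powi e = 1"
    by (auto simp: scalars_eq power_int_mult)
qed

lemma proj_hom: "proj G H \<in> hom (matrix_group G) Q"
  using N.r_coset_hom_Mod by (simp add: proj_def[abs_def])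

lemma proj_in_Q: "A \<in> G \<Longrightarrow> proj G H A \<in> carrier Q"
  using proj_hom by (auto simp: hom_def)

lemma carrier_Q: "carrier Q = proj G H ` G"
  by (simp add: carrier_FactGroup proj_def)

lemma mem_projD: "B \<in> proj G H A \<Longrightarrow> \<exists>c\<in>scalars. B = mat c ** A"
  by (auto simp: proj_def r_coset_def mem_H_iff)

lemma self_in_proj: "A \<in> G \<Longrightarrow> A \<in> proj G H A"
  using G.rcos_self[of A H] subgroup_H by (simp add: proj_def)

lemma proj_scalar_mult: "c \<in> scalars \<Longrightarrow> A \<in> G \<Longrightarrow> proj G H (mat c ** A) = proj G H A"
  using G.repr_independence[of "mat c ** A" H A] G.rcosI[of "mat c" H A] subgroup_H H_subset
  by (simp add: proj_def scalars_def)

section \<open>The group of scalar tuples acting on representations\<close>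

text \<open>
  This is \<open>H\<^sup>N\<close>, whose orbits on \<open>G\<^sup>N\<close> under \<open>twist\<close> are the fibres of \<open>psi\<close>.
\<close>

definition tuple_group :: "(nat \<Rightarrow> complex) monoid" where
  "tuple_group = product_group {..<N} (\<lambda>_. scalar_group)"

definition twist :: "(nat \<Rightarrow> complex) \<Rightarrow> (nat \<Rightarrow> 'd cmat) \<Rightarrow> (nat \<Rightarrow> 'd cmat)" where
  "twist t A = (\<lambda>i\<in>{..<N}. mat (t i) ** A i)"

lemma group_tuple_group: "group tuple_group"
  by (simp add: tuple_group_def group_scalar_group)

lemma carrier_tuple_group: "carrier tuple_group = {..<N} \<rightarrow>\<^sub>E scalars"
  by (simp add: tuple_group_def scalar_group_def)

lemma finite_tuple_group: "finite (carrier tuple_group)"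
  by (simp add: carrier_tuple_group finite_PiE finite_scalars)

lemma tuple_group_nth: "t \<in> carrier tuple_group \<Longrightarrow> i < N \<Longrightarrow> t i \<in> scalars"
  by (auto simp: carrier_tuple_group)

lemma mult_tuple_group_nth: "i < N \<Longrightarrow> (s \<otimes>\<^bsub>tuple_group\<^esub> t) i = s i * t i"
  by (simp add: tuple_group_def scalar_group_def)

lemma single_in_tuple_group: "c \<in> scalars \<Longrightarrow> (\<lambda>i\<in>{..<N}. if i = k then c else 1) \<in> carrier tuple_group"
  by (auto simp: carrier_tuple_group)

lemma X_nth: "A \<in> X \<Longrightarrow> i < N \<Longrightarrow> A i \<in> G"
  by (auto simp: rep_variety_def)

lemma twist_in_X: "t \<in> carrier tuple_group \<Longrightarrow> A \<in> X \<Longrightarrow> twist t A \<in> X"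
  by (auto simp: rep_variety_def twist_def intro!: mult_in_G scalars_in_G tuple_group_nth)

lemma psi_in_Y: "A \<in> X \<Longrightarrow> psi G H N A \<in> Y"
  by (auto simp: rep_variety_def psi_def intro!: proj_in_Q)

lemma psi_surj:
  assumes "y \<in> Y"
  obtains A where "A \<in> X" "psi G H N A = y"
proof -
  have "\<exists>a. a \<in> G \<and> y i = proj G H a" if "i < N" for i
    using PiE_mem[OF assms[unfolded rep_variety_def], of i] that carrier_Q by auto
  then obtain a where a: "\<And>i. i < N \<Longrightarrow> a i \<in> G \<and> y i = proj G H (a i)"
    by metis
  show thesis
  proof
    show "(\<lambda>i\<in>{..<N}. a i) \<in> X"
      using a by (auto simp: rep_variety_def)
    have "y \<in> extensional {..<N}"
      using assms by (auto simp: rep_variety_def PiE_def)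
    then show "psi G H N (\<lambda>i\<in>{..<N}. a i) = y"
      by (rule extensionalityI[rotated]) (auto simp: psi_def a)
  qed
qed

lemma psi_twist: "t \<in> carrier tuple_group \<Longrightarrow> A \<in> X \<Longrightarrow> psi G H N (twist t A) = psi G H N A"
  unfolding psi_def by (intro restrict_ext) (auto simp: twist_def proj_scalar_mult tuple_group_nth X_nth)

lemma conjugate_in_X: "g \<in> G \<Longrightarrow> A \<in> X \<Longrightarrow> conjugate (matrix_group G) N g A \<in> X"
  using G.inv_closed[of g] by (auto simp: rep_variety_def conjugate_def intro!: mult_in_G)

lemma conjugate_in_Y:
  assumes "g \<in> carrier Q" "y \<in> Y"
  shows "conjugate Q N g y \<in> Y"
proof -
  interpret Q: group Q
    by (rule N.factorgroup_is_group)
  show ?thesis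
    using assms unfolding rep_variety_def conjugate_def by (auto intro!: Q.m_closed simp del: mult_FactGroup)
qed

lemma psi_conjugate:
  assumes "g \<in> G" "A \<in> X"
  shows "psi G H N (conjugate (matrix_group G) N g A) = conjugate Q N (proj G H g) (psi G H N A)"
proof -
  interpret P: group_hom "matrix_group G" Q "proj G H"
    by (intro group_hom.intro group_hom_axioms.intro proj_hom N.factorgroup_is_group G.is_group)
  have "proj G H (g \<otimes>\<^bsub>matrix_group G\<^esub> A i \<otimes>\<^bsub>matrix_group G\<^esub> inv\<^bsub>matrix_group G\<^esub> g) =
        proj G H g \<otimes>\<^bsub>Q\<^esub> proj G H (A i) \<otimes>\<^bsub>Q\<^esub> inv\<^bsub>Q\<^esub> (proj G H g)" if "i < N" for i
    using assms(1) X_nth[OF assms(2) that] G.inv_closed[of g] G.m_closed[of g "A i"]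
    by (simp only: P.hom_mult P.hom_inv G.m_closed matrix_group_simps(1))
  then show ?thesis
    by (auto simp: psi_def conjugate_def intro!: restrict_ext)
qed

section \<open>Regular functions on the quotient\<close>

text \<open>
  The generators of the coordinate ring of \<open>G\<close>: the matrix entries, and \<open>1/det\<close> under the index \<open>None\<close>.
  A scalar \<open>c\<close> acts on the generator with index \<open>a\<close> by the character \<open>weight a c\<close>.
\<close>

definition coord :: "('d \<times> 'd) option \<Rightarrow> 'd cmat \<Rightarrow> complex" where
  "coord a A = (case a of None \<Rightarrow> 1 / det A | Some (i, j) \<Rightarrow> A $ i $ j)"

definition weight :: "('d \<times> 'd) option \<Rightarrow> complex \<Rightarrow> complex" where
  "weight a c = (case a of None \<Rightarrow> 1 / c ^ CARD('d) | Some _ \<Rightarrow> c)"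

lemma coord_scalar_mult: "coord a (mat c ** A) = weight a c * coord a A"
  by (auto simp: coord_def weight_def det_mul det_mat scalar_mult_nth split: option.split)

lemma weight_mult: "weight a (b * c) = weight a b * weight a c"
  by (auto simp: weight_def power_mult_distrib split: option.split)

lemma weight_one [simp]: "weight a 1 = 1"
  by (auto simp: weight_def split: option.split)

lemma matrix_coord_ring_eq: "matrix_coord_ring G = alg_generated G (range (\<lambda>a. \<lambda>A\<in>G. coord a A))"
proof -
  have "insert (\<lambda>A\<in>G. 1 / det A) (entries G) = range (\<lambda>a. \<lambda>A\<in>G. coord a A)" (is "?l = ?r")
  proof
    show "?l \<subseteq> ?r"
      by (auto simp: entries_def coord_def intro: range_eqI[of _ _ None] range_eqI[of _ _ "Some (_, _)"])
    show "?r \<subseteq> ?l"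
    proof (rule image_subsetI)
      fix a :: "('d \<times> 'd) option"
      show "(\<lambda>A\<in>G. coord a A) \<in> ?l"
        by (cases a) (auto simp: entries_def coord_def[abs_def])
    qed
  qed
  then show ?thesis
    by (simp add: matrix_coord_ring_def)
qed

lemma rep_coord_ring_coords:
  assumes "p \<in> rep_coord_ring (matrix_group G) (matrix_coord_ring G) N"
  shows "p \<in> alg_generated X ((\<lambda>(k, a). \<lambda>A\<in>X. coord a (A k)) ` ({..<N} \<times> UNIV))"
    (is "_ \<in> alg_generated X ?S")
proof -
  have gens: "(\<lambda>A\<in>X. f (A k)) \<in> alg_generated X ?S" if f: "f \<in> matrix_coord_ring G" and k: "k < N" for f k
  proof (rule alg_generated_pullback[where \<phi> = "\<lambda>A. A k"])
    show "f \<in> alg_generated G (range (\<lambda>a. \<lambda>A\<in>G. coord a A))"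
      using f by (simp add: matrix_coord_ring_eq)
    show "(\<lambda>A. A k) \<in> X \<rightarrow> G"
      using k by (auto intro: X_nth)
    fix s assume "s \<in> range (\<lambda>a. \<lambda>A\<in>G. coord a A)"
    then obtain a where s: "s = (\<lambda>A\<in>G. coord a A)"
      by blast
    have "(\<lambda>A\<in>X. s (A k)) = (\<lambda>A\<in>X. coord a (A k))"
      using k by (intro restrict_ext) (simp add: s X_nth)
    then show "(\<lambda>A\<in>X. s (A k)) \<in> alg_generated X ?S"
      using k by (auto intro!: alg_generated.gen image_eqI[of _ _ "(k, a)"])
  qed
  have "(\<lambda>A\<in>X. p (id A)) \<in> alg_generated X ?S"
  proof (rule alg_generated_pullback[where \<phi> = id])
    show "p \<in> alg_generated X {\<lambda>A\<in>X. f (A k) | f k. f \<in> matrix_coord_ring G \<and> k < N}"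
      using assms by (simp add: rep_coord_ring_def)
    fix s assume "s \<in> {\<lambda>A\<in>X. f (A k) | f k. f \<in> matrix_coord_ring G \<and> k < N}"
    then obtain f k where s: "s = (\<lambda>A\<in>X. f (A k))" "f \<in> matrix_coord_ring G" "k < N"
      by blast
    have "(\<lambda>A\<in>X. s (id A)) = (\<lambda>A\<in>X. f (A k))"
      by (intro restrict_ext) (simp add: s)
    then show "(\<lambda>A\<in>X. s (id A)) \<in> alg_generated X ?S"
      using gens[OF s(2,3)] by (simp only:)
  qed simp
  moreover have "p \<in> extensional X"
    by (rule alg_generated_extensional[OF _ assms[unfolded rep_coord_ring_def]]) auto
  ultimately show ?thesis
    by (simp add: extensional_restrict)
qed

text \<open>
  The elements of the coset of \<open>A\<close> are the scalar multiples of \<open>A\<close> by elements of \<open>H\<close>, so \<open>F\<close> is constant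
  on cosets.
\<close>

lemma scalar_invariant_descends:
  assumes F: "F \<in> matrix_coord_ring G"
    and inv: "\<And>c A. c \<in> scalars \<Longrightarrow> A \<in> G \<Longrightarrow> F (mat c ** A) = F A"
  shows "\<exists>r\<in>quotient_coord_ring G H. \<forall>A\<in>G. r (proj G H A) = F A"
proof -
  define r where "r = (\<lambda>C\<in>carrier Q. F (SOME A. A \<in> C))"
  have r: "r (proj G H A) = F A" if A: "A \<in> G" for A
  proof -
    have "(SOME B. B \<in> proj G H A) \<in> proj G H A"
      using self_in_proj[OF A] by (rule someI)
    then show ?thesis
      using mem_projD inv A by (fastforce simp: r_def proj_in_Q)
  qed
  have "F \<in> extensional G"
    by (rule alg_generated_extensional[OF _ F[unfolded matrix_coord_ring_eq]]) auto
  then have "(\<lambda>A\<in>G. r (proj G H A)) = F"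
    using r by (intro ext) (auto simp: extensional_def)
  then have "r \<in> quotient_coord_ring G H"
    using F by (simp add: quotient_coord_ring_def r_def del: carrier_FactGroup)
  then show ?thesis
    using r by blast
qed

text \<open>
  Such a monomial is a product over \<open>k < N\<close> of functions of the single matrix \<open>A k\<close>. Testing triviality of
  the character on tuples that are \<open>1\<close> outside position \<open>k\<close> shows that the \<open>k\<close>-th factor is itself invariant
  under \<open>H\<close>. Hence each factor, and with it the product, descends to the quotient.
\<close>

lemma coord_monomial_descends:
  assumes "is": "set is \<subseteq> {..<N} \<times> UNIV"
    and triv: "\<forall>t\<in>carrier tuple_group. (\<Prod>(k, a)\<leftarrow>is. weight a (t k)) = 1"
  shows "\<exists>q\<in>rep_coord_ring Q (quotient_coord_ring G H) N.
           \<forall>A\<in>X. q (psi G H N A) = (\<Prod>(k, a)\<leftarrow>is. coord a (A k))"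
proof -
  \<comment> \<open>The inner restriction makes each factor literally one of the generators of the coordinate ring.\<close>
  define F where "F k = (\<lambda>B\<in>G. \<Prod>l\<leftarrow>filter (\<lambda>l. fst l = k) is. (\<lambda>B\<in>G. coord (snd l) B) B)" for k
  have coord_regular: "(\<lambda>B\<in>G. coord a B) \<in> matrix_coord_ring G" for a
    unfolding matrix_coord_ring_eq by (rule alg_generated.gen, rule range_eqI[where x = a], rule refl)
  have F: "F k \<in> matrix_coord_ring G" for k
    unfolding F_def matrix_coord_ring_def
    by (rule alg_generated_prod_list[where F = "\<lambda>l. \<lambda>B\<in>G. coord (snd l) B"])
      (rule coord_regular[unfolded matrix_coord_ring_def])
  have F_eq: "F k B = (\<Prod>l\<leftarrow>filter (\<lambda>l. fst l = k) is. coord (snd l) B)" if "B \<in> G" for k B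
    using that by (simp add: F_def)
  have inv: "F k (mat c ** B) = F k B" if k: "k < N" and c: "c \<in> scalars" and B: "B \<in> G" for k c B
  proof -
    let ?t = "\<lambda>i\<in>{..<N}. if i = k then c else 1"
    have "(\<Prod>l\<leftarrow>filter (\<lambda>l. fst l = k) is. weight (snd l) c) =
          (\<Prod>l\<leftarrow>filter (\<lambda>l. fst l = k) is. weight (snd l) (?t (fst l)))"
      using k by (intro arg_cong[where f = prod_list] map_cong) auto
    also have "\<dots> = (\<Prod>l\<leftarrow>is. weight (snd l) (?t (fst l)))"
      using "is" by (intro prod_list_filter) auto
    also have "\<dots> = 1"
      using bspec[OF triv single_in_tuple_group[OF c, of k]] by (simp add: case_prod_unfold)
    finally have "(\<Prod>l\<leftarrow>filter (\<lambda>l. fst l = k) is. weight (snd l) c) = 1" .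
    then show ?thesis
      using c B by (simp add: F_eq mult_in_G scalars_in_G coord_scalar_mult prod_list_mult_distrib)
  qed
  have "\<forall>k\<in>{..<N}. \<exists>r. r \<in> quotient_coord_ring G H \<and> (\<forall>B\<in>G. r (proj G H B) = F k B)"
    using scalar_invariant_descends[OF F] inv by blast
  then obtain r where r: "\<And>k. k < N \<Longrightarrow> r k \<in> quotient_coord_ring G H"
    "\<And>k B. k < N \<Longrightarrow> B \<in> G \<Longrightarrow> r k (proj G H B) = F k B"
    by (metis lessThan_iff)
  show ?thesis
  proof (intro bexI ballI)
    show "(\<lambda>y\<in>Y. \<Prod>k<N. (\<lambda>y\<in>Y. r k (y k)) y) \<in> rep_coord_ring Q (quotient_coord_ring G H) N"
      unfolding rep_coord_ring_def using r(1)
      by (intro alg_generated_prod[where F = "\<lambda>k. \<lambda>y\<in>Y. r k (y k)"] alg_generated.gen finite_lessThan) blast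
    fix A assume A: "A \<in> X"
    have "(\<lambda>y\<in>Y. \<Prod>k<N. (\<lambda>y\<in>Y. r k (y k)) y) (psi G H N A) = (\<Prod>k<N. r k (proj G H (A k)))"
      using psi_in_Y[OF A] by (simp add: psi_def)
    also have "\<dots> = (\<Prod>k<N. \<Prod>l\<leftarrow>filter (\<lambda>l. fst l = k) is. coord (snd l) (A (fst l)))"
      using A by (intro prod.cong refl) (auto simp: r X_nth F_eq intro!: arg_cong[where f = prod_list])
    also have "\<dots> = (\<Prod>l\<leftarrow>is. coord (snd l) (A (fst l)))"
      using "is" by (intro prod_list_group[symmetric]) auto
    finally show "(\<lambda>y\<in>Y. \<Prod>k<N. (\<lambda>y\<in>Y. r k (y k)) y) (psi G H N A) = (\<Prod>(k, a)\<leftarrow>is. coord a (A k))"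
      by (simp add: case_prod_unfold)
  qed
qed

text \<open>
  In geometric terms, \<open>(G/H)\<^sup>N\<close> is the quotient of the variety \<open>G\<^sup>N\<close> by \<open>H\<^sup>N\<close>.
\<close>

lemma regular_invariant_descends:
  assumes p: "p \<in> rep_coord_ring (matrix_group G) (matrix_coord_ring G) N"
    and inv: "\<And>t A. t \<in> carrier tuple_group \<Longrightarrow> A \<in> X \<Longrightarrow> p (twist t A) = p A"
  shows "\<exists>q\<in>rep_coord_ring Q (quotient_coord_ring G H) N. \<forall>A\<in>X. q (psi G H N A) = p A"
  unfolding rep_coord_ring_def
proof (rule invariant_descends[where act = twist and \<phi> = "psi G H N" and I = "{..<N} \<times> UNIV"
      and \<sigma> = "\<lambda>(k, a). \<lambda>A\<in>X. coord a (A k)" and \<eta> = "\<lambda>(k, a) t. weight a (t k)", OF group_tuple_group finite_tuple_group])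
  show "p \<in> alg_generated X ((\<lambda>(k, a). \<lambda>A\<in>X. coord a (A k)) ` ({..<N} \<times> UNIV))"
    by (rule rep_coord_ring_coords[OF p])
next
  fix l :: "nat \<times> ('d \<times> 'd) option" and s t
  assume "l \<in> {..<N} \<times> UNIV"
  then show "(case l of (k, a) \<Rightarrow> \<lambda>t. weight a (t k)) (s \<otimes>\<^bsub>tuple_group\<^esub> t) =
      (case l of (k, a) \<Rightarrow> \<lambda>t. weight a (t k)) s * (case l of (k, a) \<Rightarrow> \<lambda>t. weight a (t k)) t"
    by (auto simp: mult_tuple_group_nth weight_mult)
next
  fix l :: "nat \<times> ('d \<times> 'd) option" and t A
  assume "l \<in> {..<N} \<times> UNIV" "t \<in> carrier tuple_group" "A \<in> X"
  then show "(case l of (k, a) \<Rightarrow> \<lambda>A\<in>X. coord a (A k)) (twist t A) =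
      (case l of (k, a) \<Rightarrow> \<lambda>t. weight a (t k)) t * (case l of (k, a) \<Rightarrow> \<lambda>A\<in>X. coord a (A k)) A"
    using twist_in_X[of t A] by (auto simp: twist_def coord_scalar_mult)
next
  fix "is" :: "(nat \<times> ('d \<times> 'd) option) list"
  assume "set is \<subseteq> {..<N} \<times> UNIV"
    "\<forall>t\<in>carrier tuple_group. (\<Prod>i\<leftarrow>is. (case i of (k, a) \<Rightarrow> \<lambda>t. weight a (t k)) t) = 1"
  then show "\<exists>q\<in>alg_generated Y {\<lambda>A\<in>Y. f (A i) |f i. f \<in> quotient_coord_ring G H \<and> i < N}.
      \<forall>A\<in>X. q (psi G H N A) = (\<Prod>i\<leftarrow>is. (case i of (k, a) \<Rightarrow> \<lambda>A\<in>X. coord a (A k)) A)"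
    using coord_monomial_descends[of "is"] unfolding rep_coord_ring_def
    by (simp add: case_prod_unfold)
qed (use psi_in_Y twist_in_X inv in auto)

section \<open>Character functions and the projection\<close>

text \<open>
  Invariance under conjugation is inherited by the descended function because \<open>psi\<close> is onto and
  compatible with conjugation.
\<close>

lemma invariant_character_function_descends:
  assumes p: "p \<in> char_ring G N"
    and inv: "\<And>t A. t \<in> carrier tuple_group \<Longrightarrow> A \<in> X \<Longrightarrow> p (twist t A) = p A"
  shows "\<exists>q\<in>quotient_char_ring G H N. \<forall>A\<in>X. q (psi G H N A) = p A"
proof -
  obtain q where q: "q \<in> rep_coord_ring Q (quotient_coord_ring G H) N" "\<forall>A\<in>X. q (psi G H N A) = p A"
    using regular_invariant_descends[OF _ inv] p by (auto simp: char_coord_ring_def)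
  have "q (conjugate Q N g y) = q y" if "g \<in> carrier Q" "y \<in> Y" for g y
  proof -
    obtain a where a: "a \<in> G" "g = proj G H a"
      using \<open>g \<in> carrier Q\<close> carrier_Q by blast
    obtain A where A: "A \<in> X" "psi G H N A = y"
      using \<open>y \<in> Y\<close> by (rule psi_surj)
    have "q (conjugate Q N g y) = q (psi G H N (conjugate (matrix_group G) N a A))"
      using a A by (simp add: psi_conjugate)
    then show ?thesis
      using q(2) a A char_ring_invariant[OF p, of a A] conjugate_in_X[of a A] by auto
  qed
  then show ?thesis
    using q by (auto simp: char_coord_ring_def)
qed

lemma psi_pullback:
  assumes f: "f \<in> quotient_char_ring G H N"
  shows "(\<lambda>A\<in>X. f (psi G H N A)) \<in> char_ring G N"
proof -
  have "(\<lambda>A\<in>X. f (psi G H N A)) \<in> rep_coord_ring (matrix_group G) (matrix_coord_ring G) N"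
    unfolding rep_coord_ring_def
  proof (rule alg_generated_pullback[where \<phi> = "psi G H N"])
    show "f \<in> alg_generated Y {\<lambda>y\<in>Y. r (y i) | r i. r \<in> quotient_coord_ring G H \<and> i < N}"
      using f by (simp add: char_coord_ring_def rep_coord_ring_def)
    show "psi G H N \<in> X \<rightarrow> Y"
      using psi_in_Y by blast
    fix s assume "s \<in> {\<lambda>y\<in>Y. r (y i) | r i. r \<in> quotient_coord_ring G H \<and> i < N}"
    then obtain r i where s: "s = (\<lambda>y\<in>Y. r (y i))" and r: "r \<in> quotient_coord_ring G H" and i: "i < N"
      by blast
    have "(\<lambda>A\<in>X. s (psi G H N A)) = (\<lambda>A\<in>X. (\<lambda>B\<in>G. r (proj G H B)) (A i))"
      using i psi_in_Y X_nth by (intro restrict_ext) (simp add: s psi_def)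
    then show "(\<lambda>A\<in>X. s (psi G H N A)) \<in>
        alg_generated X {\<lambda>A\<in>X. f (A i) | f i. f \<in> matrix_coord_ring G \<and> i < N}"
      using r i unfolding quotient_coord_ring_def by (intro alg_generated.gen) blast
  qed
  moreover have "f (psi G H N (conjugate (matrix_group G) N g A)) = f (psi G H N A)"
    if "g \<in> G" "A \<in> X" for g A
    using that char_ring_invariant[OF f proj_in_Q psi_in_Y] by (simp add: psi_conjugate)
  ultimately show ?thesis
    by (simp add: char_coord_ring_def conjugate_in_X)
qed

lemma quotient_char_ring_extensional:
  assumes "f \<in> quotient_char_ring G H N"
  shows "f \<in> extensional Y"
proof -
  have "f \<in> rep_coord_ring Q (quotient_coord_ring G H) N"
    using assms by (simp add: char_coord_ring_def)
  then show ?thesis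
    unfolding rep_coord_ring_def by (rule alg_generated_extensional[rotated]) auto
qed

lemma eq_if_eq_on_psi:
  assumes "f \<in> extensional Y" "g \<in> extensional Y" "\<And>A. A \<in> X \<Longrightarrow> f (psi G H N A) = g (psi G H N A)"
  shows "f = g"
  using assms(1,2) by (rule extensionalityI) (metis assms(3) psi_surj)

section \<open>Weights of trace functions\<close>

text \<open>
  The integer whose residue mod \<open>m\<close> is the \<open>i\<close>-th component of the exponent vector. Integers are kept here
  since they can be used as exponents of scalars.
\<close>

definition exponent_sum :: "nat \<Rightarrow> letter list \<Rightarrow> int" where
  "exponent_sum i w = (\<Sum>a\<leftarrow>w. if fst a = i then (if snd a then 1 else - 1) else 0)"

lemma letter_eval_twist:
  assumes t: "t \<in> carrier tuple_group" and A: "A \<in> X" and a: "fst a < N"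
  shows "letter_eval (matrix_group G) (twist t A) a =
         mat (t (fst a) powi (if snd a then 1 else - 1)) ** letter_eval (matrix_group G) A a"
proof -
  let ?c = "t (fst a)" and ?A = "A (fst a)"
  have c: "?c \<in> scalars" and A': "?A \<in> G"
    using assms by (auto intro: tuple_group_nth X_nth)
  have "inv\<^bsub>matrix_group G\<^esub> (mat ?c ** ?A) = inv\<^bsub>matrix_group G\<^esub> ?A ** inv\<^bsub>matrix_group G\<^esub> (mat ?c)"
    using G.inv_mult_group[of "mat ?c" ?A] A' scalars_in_G[OF c] by simp
  then show ?thesis
    using a by (simp add: letter_eval_def twist_def inv_scalar[OF c] scalar_commute power_int_minus)
qed

text \<open>
  Scalars are central, so all factors \<open>t i\<close> can be collected in front of the word.
\<close>

lemma word_eval_twist: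
  assumes t: "t \<in> carrier tuple_group" and A: "A \<in> X"
  shows "fst ` set w \<subseteq> {..<N} \<Longrightarrow> word_eval (matrix_group G) (twist t A) w =
    mat (\<Prod>i<N. t i powi exponent_sum i w) ** word_eval (matrix_group G) A w"
proof (induction w)
  case Nil
  show ?case
    by (simp add: word_eval_def exponent_sum_def)
next
  case (Cons a w)
  let ?e = "if snd a then 1 else - 1 :: int"
  have a: "fst a < N"
    using Cons.prems by simp
  have "(\<Prod>i<N. t i powi exponent_sum i (a # w)) = (\<Prod>i<N. (if i = fst a then t i powi ?e else 1) * t i powi exponent_sum i w)"
    using scalars_nonzero tuple_group_nth[OF t] by (intro prod.cong) (auto simp: exponent_sum_def power_int_add)
  also have "\<dots> = t (fst a) powi ?e * (\<Prod>i<N. t i powi exponent_sum i w)"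
    using a by (simp add: prod.distrib)
  finally have weight: "mat (\<Prod>i<N. t i powi exponent_sum i (a # w)) =
      (mat (t (fst a) powi ?e) ** mat (\<Prod>i<N. t i powi exponent_sum i w) :: 'd cmat)"
    by (simp only: mat_mult_mat)
  have "word_eval (matrix_group G) (twist t A) (a # w) =
      (mat (t (fst a) powi ?e) ** letter_eval (matrix_group G) A a) **
      (mat (\<Prod>i<N. t i powi exponent_sum i w) ** word_eval (matrix_group G) A w)"
    using Cons letter_eval_twist[OF t A a] by (simp add: word_eval_def)
  also have "\<dots> = mat (t (fst a) powi ?e) **
      (letter_eval (matrix_group G) A a ** mat (\<Prod>i<N. t i powi exponent_sum i w)) ** word_eval (matrix_group G) A w"
    by (simp only: matrix_mul_assoc)
  also have "\<dots> = mat (t (fst a) powi ?e) ** mat (\<Prod>i<N. t i powi exponent_sum i w) **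
      (letter_eval (matrix_group G) A a ** word_eval (matrix_group G) A w)"
    by (simp only: matrix_mul_assoc scalar_commute[symmetric, of "letter_eval (matrix_group G) A a"])
  also have "\<dots> = mat (\<Prod>i<N. t i powi exponent_sum i (a # w)) ** word_eval (matrix_group G) A (a # w)"
    by (simp only: weight) (simp add: word_eval_def)
  finally show ?case .
qed

lemma tau_twist:
  assumes "t \<in> carrier tuple_group" "A \<in> X" "w \<in> carrier (free_group N)"
  shows "tau G N w (twist t A) = (\<Prod>i<N. t i powi exponent_sum i w) * tau G N w A"
  using assms by (simp add: tau_def twist_in_X word_eval_twist trace_scalar_mult free_group_def)

lemma zero_sum_iff:
  "zero_sum m N (mset (map (exponent_vector m N) ws)) \<longleftrightarrow> (\<forall>i<N. int m dvd (\<Sum>w\<leftarrow>ws. exponent_sum i w))"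
proof -
  have "(\<Sum>w\<leftarrow>ws. exponent_vector m N w i) mod int m = (\<Sum>w\<leftarrow>ws. exponent_sum i w) mod int m" if "i < N" for i
    using that by (induction ws) (auto simp: exponent_vector_def exponent_sum_def mod_simps intro: mod_add_cong)
  then show ?thesis
    by (auto simp: zero_sum_def dvd_eq_mod_eq_0 sum_mset_sum_list comp_def simp flip: mset_map)
qed

lemma weight_of_product:
  assumes "t \<in> carrier tuple_group"
  shows "(\<Prod>w\<leftarrow>ws. \<Prod>i<N. t i powi exponent_sum i w) = (\<Prod>i<N. t i powi (\<Sum>w\<leftarrow>ws. exponent_sum i w))"
proof -
  have "(\<Prod>w\<leftarrow>ws. \<Prod>i<N. t i powi exponent_sum i w) = (\<Prod>i<N. \<Prod>w\<leftarrow>ws. t i powi exponent_sum i w)"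
    by (induction ws) (simp_all add: prod.distrib)
  also have "\<dots> = (\<Prod>i<N. t i powi (\<Sum>w\<leftarrow>ws. exponent_sum i w))"
    using scalars_nonzero tuple_group_nth[OF assms] by (intro prod.cong refl prod_list_powi) auto
  finally show ?thesis .
qed

text \<open>
  The link between the combinatorics of exponent vectors and the action of \<open>H\<^sup>N\<close>: a product of trace functions
  has trivial character exactly when its exponent vectors add up to zero. For the direction from left to right, the
  tuples that are \<open>1\<close> outside one position detect the components one at a time.
\<close>

lemma trivial_weight_iff_zero_sum:
  "(\<forall>t\<in>carrier tuple_group. (\<Prod>w\<leftarrow>ws. \<Prod>i<N. t i powi exponent_sum i w) = 1) \<longleftrightarrow>
   zero_sum m N (mset (map (exponent_vector m N) ws))"
  unfolding zero_sum_iff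
proof (intro iffI allI impI ballI)
  fix k assume triv: "\<forall>t\<in>carrier tuple_group. (\<Prod>w\<leftarrow>ws. \<Prod>i<N. t i powi exponent_sum i w) = 1" and k: "k < N"
  have "c powi (\<Sum>w\<leftarrow>ws. exponent_sum k w) = 1" if c: "c \<in> scalars" for c
  proof -
    let ?t = "\<lambda>i\<in>{..<N}. if i = k then c else 1"
    have "(\<Prod>i<N. ?t i powi (\<Sum>w\<leftarrow>ws. exponent_sum i w)) =
        (\<Prod>i<N. if i = k then c powi (\<Sum>w\<leftarrow>ws. exponent_sum k w) else 1)"
      by (intro prod.cong) auto
    then show ?thesis
      using k bspec[OF triv single_in_tuple_group[OF c, of k]]
      unfolding weight_of_product[OF single_in_tuple_group[OF c, of k]] by simp
  qed
  then show "int m dvd (\<Sum>w\<leftarrow>ws. exponent_sum k w)"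
    using trivial_power_iff by blast
next
  fix t assume "\<forall>i<N. int m dvd (\<Sum>w\<leftarrow>ws. exponent_sum i w)" and t: "t \<in> carrier tuple_group"
  then show "(\<Prod>w\<leftarrow>ws. \<Prod>i<N. t i powi exponent_sum i w) = 1"
    unfolding weight_of_product[OF t] using trivial_power_iff tuple_group_nth[OF t] by (intro prod.neutral) blast
qed

end

section \<open>The generating set\<close>

locale trace_generated = scalar_quotient G H m N
  for G H :: "'d::finite cmat set" and m N :: nat +
  fixes B :: "letter list set"
  assumes B_words: "B \<subseteq> carrier (free_group N)"
    and generated: "alg_generated X (tau G N ` B) = char_ring G N"
begin

text \<open>
  The product of trace functions is regular and conjugation invariant on \<open>G\<^sup>N\<close> since it lies in the
  algebra generated by the trace functions of \<open>B\<close>, and it is invariant under \<open>H\<^sup>N\<close> since its character is trivial, so it descends. Surjectivity of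
  \<open>psi\<close> gives uniqueness. The definite description of \<open>lambda_fun\<close> therefore denotes this function.
\<close>

lemma
  assumes ws: "set ws \<subseteq> B" and zero: "zero_sum m N (mset (map (exponent_vector m N) ws))"
  shows lambda_fun_in_quotient_char_ring: "lambda_fun G H N ws \<in> quotient_char_ring G H N"
    and lambda_fun_psi: "\<And>A. A \<in> X \<Longrightarrow> lambda_fun G H N ws (psi G H N A) = (\<Prod>w\<leftarrow>ws. tau G N w A)"
proof -
  let ?p = "\<lambda>A\<in>X. \<Prod>w\<leftarrow>ws. tau G N w A"
  have "?p \<in> char_ring G N"
    unfolding generated[symmetric] using ws by (intro alg_generated_prod_list alg_generated.gen) auto
  moreover have "?p (twist t A) = ?p A" if t: "t \<in> carrier tuple_group" and A: "A \<in> X" for t A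
  proof -
    have "(\<Prod>w\<leftarrow>ws. tau G N w (twist t A)) = (\<Prod>w\<leftarrow>ws. (\<Prod>i<N. t i powi exponent_sum i w) * tau G N w A)"
      using ws B_words t A by (intro arg_cong[where f = prod_list] map_cong refl tau_twist) auto
    also have "\<dots> = (\<Prod>w\<leftarrow>ws. tau G N w A)"
      using zero t unfolding trivial_weight_iff_zero_sum[symmetric] by (simp add: prod_list_mult_distrib)
    finally show ?thesis
      using t A by (simp add: twist_in_X)
  qed
  ultimately obtain q where q: "q \<in> quotient_char_ring G H N" "\<forall>A\<in>X. q (psi G H N A) = (\<Prod>w\<leftarrow>ws. tau G N w A)"
    using invariant_character_function_descends[of ?p] by auto
  have "\<exists>!f. f \<in> quotient_char_ring G H N \<and> (\<forall>A\<in>X. f (psi G H N A) = (\<Prod>w\<leftarrow>ws. tau G N w A))"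
  proof (rule ex1I)
    show "q \<in> quotient_char_ring G H N \<and> (\<forall>A\<in>X. q (psi G H N A) = (\<Prod>w\<leftarrow>ws. tau G N w A))"
      using q by blast
    fix f assume "f \<in> quotient_char_ring G H N \<and> (\<forall>A\<in>X. f (psi G H N A) = (\<Prod>w\<leftarrow>ws. tau G N w A))"
    then show "f = q"
      using q by (intro eq_if_eq_on_psi quotient_char_ring_extensional) auto
  qed
  from theI'[OF this]
  show "lambda_fun G H N ws \<in> quotient_char_ring G H N"
    and "\<And>A. A \<in> X \<Longrightarrow> lambda_fun G H N ws (psi G H N A) = (\<Prod>w\<leftarrow>ws. tau G N w A)"
    unfolding lambda_fun_def by blast+
qed

lemma minimal_zero_sums_iff:
  "mset (map (exponent_vector m N) ws) \<in> minimal_zero_sums m N \<longleftrightarrow>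
     ws \<noteq> [] \<and> zero_sum m N (mset (map (exponent_vector m N) ws)) \<and>
     (\<forall>K. K \<subset># mset (map (exponent_vector m N) ws) \<and> K \<noteq> {#} \<longrightarrow> \<not> zero_sum m N K)"
  using m_pos by (auto simp: minimal_zero_sums_def exponent_vector_def)

lemma zero_sum_diff: "zero_sum m N (K + L) \<Longrightarrow> zero_sum m N K \<Longrightarrow> zero_sum m N L"
  unfolding zero_sum_def by (auto simp flip: dvd_eq_mod_eq_0 simp: dvd_add_right_iff)

text \<open>
  A zero sum that is not minimal splits into two smaller zero sums, and the product of trace functions
  splits accordingly. The induction ends with the minimal zero sums, where the product is the pullback of
  one of the generators, and with the empty one, where it is constant.
\<close>

lemma zero_sum_product_descends:
  assumes "set_mset M \<subseteq> B" "zero_sum m N (image_mset (exponent_vector m N) M)"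
  shows "\<exists>q\<in>alg_generated Y (lambda_set G H m N B). \<forall>A\<in>X. q (psi G H N A) = (\<Prod>w\<in>#M. tau G N w A)"
  using assms
proof (induction "size M" arbitrary: M rule: less_induct)
  case less
  obtain ws where ws: "M = mset ws"
    by (metis ex_mset)
  consider "M = {#}" | "image_mset (exponent_vector m N) M \<in> minimal_zero_sums m N"
    | K where "M \<noteq> {#}" "K \<subset># image_mset (exponent_vector m N) M" "K \<noteq> {#}" "zero_sum m N K"
    using minimal_zero_sums_iff[of ws] less.prems by (auto simp: ws)
  then show ?case
  proof cases
    case 1
    then show ?thesis
      using psi_in_Y by (intro bexI[of _ "\<lambda>y\<in>Y. 1"] alg_generated.const) auto
  next
    case 2
    have "lambda_fun G H N ws \<in> lambda_set G H m N B"
      using less.prems 2 by (auto simp: lambda_set_def ws)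
    then show ?thesis
      using lambda_fun_psi[of ws] less.prems
      by (intro bexI[of _ "lambda_fun G H N ws"] alg_generated.gen) (auto simp: ws prod_mset_prod_list simp flip: mset_map)
  next
    case 3
    obtain L where "image_mset (exponent_vector m N) M = K + L" "L \<noteq> {#}"
      using 3(2) by (metis add.right_neutral subset_mset.less_imp_le subset_mset.less_irrefl mset_subset_eq_exists_conv)
    then obtain M1 M2 where M: "M = M1 + M2"
      and K: "K = image_mset (exponent_vector m N) M1" and L: "L = image_mset (exponent_vector m N) M2"
      by (meson image_mset_eq_plusD)
    have "M1 \<noteq> {#}" "M2 \<noteq> {#}"
      using \<open>K \<noteq> {#}\<close> \<open>L \<noteq> {#}\<close> by (auto simp: K L)
    then have size: "size M1 < size M" "size M2 < size M"
      by (auto simp: M nonempty_has_size)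
    have "zero_sum m N K" "zero_sum m N L"
      using 3 zero_sum_diff[of K L] less.prems(2) by (auto simp: M K L)
    then obtain q1 q2
      where q1: "q1 \<in> alg_generated Y (lambda_set G H m N B)" "\<forall>A\<in>X. q1 (psi G H N A) = (\<Prod>w\<in>#M1. tau G N w A)"
        and q2: "q2 \<in> alg_generated Y (lambda_set G H m N B)" "\<forall>A\<in>X. q2 (psi G H N A) = (\<Prod>w\<in>#M2. tau G N w A)"
      using less.hyps[OF size(1)] less.hyps[OF size(2)] less.prems(1) unfolding K L M by auto
    show ?thesis
      using q1 q2 psi_in_Y by (intro bexI[of _ "\<lambda>y\<in>Y. q1 y * q2 y"] alg_generated.mult) (auto simp: M)
  qed
qed

lemma lambda_set_subset: "lambda_set G H m N B \<subseteq> quotient_char_ring G H N"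
  using lambda_fun_in_quotient_char_ring by (auto simp: lambda_set_def minimal_zero_sums_def)

lemma lambda_algebra_subset: "alg_generated Y (lambda_set G H m N B) \<subseteq> quotient_char_ring G H N"
proof
  fix f assume "f \<in> alg_generated Y (lambda_set G H m N B)"
  then show "f \<in> quotient_char_ring G H N"
  proof induction
    case (const c)
    show ?case
      unfolding char_coord_ring_def rep_coord_ring_def
      by (intro CollectI conjI ballI alg_generated.const) (simp add: conjugate_in_Y)
  next
    case (gen f)
    then show ?case
      using lambda_set_subset by blast
  next
    case (add f g)
    then show ?case
      unfolding char_coord_ring_def rep_coord_ring_def
      by (intro CollectI conjI ballI alg_generated.add) (simp_all add: conjugate_in_Y)
  next
    case (mult f g)
    then show ?case
      unfolding char_coord_ring_def rep_coord_ring_def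
      by (intro CollectI conjI ballI alg_generated.mult) (simp_all add: conjugate_in_Y)
  qed
qed

text \<open>
  The pullback of \<open>f\<close> to \<open>G\<^sup>N\<close> is a polynomial in trace functions by the hypothesis on \<open>B\<close>, and is constant on
  the orbits of \<open>H\<^sup>N\<close>. So it is a combination of products of trace functions whose exponent vectors add up to
  zero, and these are pullbacks of polynomials in the generators.
\<close>

lemma quotient_char_ring_subset_lambda_algebra: "quotient_char_ring G H N \<subseteq> alg_generated Y (lambda_set G H m N B)"
proof
  fix f assume f: "f \<in> quotient_char_ring G H N"
  let ?p = "\<lambda>A\<in>X. f (psi G H N A)"
  have "\<exists>q\<in>alg_generated Y (lambda_set G H m N B). \<forall>A\<in>X. q (psi G H N A) = ?p A"
  proof (rule invariant_descends[where act = twist and \<phi> = "psi G H N" and I = B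
      and \<sigma> = "tau G N" and \<eta> = "\<lambda>w t. \<Prod>i<N. t i powi exponent_sum i w", OF group_tuple_group finite_tuple_group])
    show "?p \<in> alg_generated X (tau G N ` B)"
      unfolding generated using f by (rule psi_pullback)
  next
    fix w s t assume "s \<in> carrier tuple_group" "t \<in> carrier tuple_group"
    show "(\<Prod>i<N. (s \<otimes>\<^bsub>tuple_group\<^esub> t) i powi exponent_sum i w) = (\<Prod>i<N. s i powi exponent_sum i w) * (\<Prod>i<N. t i powi exponent_sum i w)"
      by (simp add: mult_tuple_group_nth power_int_mult_distrib prod.distrib)
  next
    fix ws assume "set ws \<subseteq> B" "\<forall>t\<in>carrier tuple_group. (\<Prod>w\<leftarrow>ws. \<Prod>i<N. t i powi exponent_sum i w) = 1"
    then show "\<exists>q\<in>alg_generated Y (lambda_set G H m N B). \<forall>A\<in>X. q (psi G H N A) = (\<Prod>w\<leftarrow>ws. tau G N w A)"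
      using zero_sum_product_descends[of "mset ws"] unfolding trivial_weight_iff_zero_sum
      by (simp add: prod_mset_prod_list flip: mset_map)
  qed (use B_words psi_in_Y in \<open>auto simp: twist_in_X psi_twist intro: tau_twist\<close>)
  then obtain q where q: "q \<in> alg_generated Y (lambda_set G H m N B)" "\<forall>A\<in>X. q (psi G H N A) = ?p A"
    by blast
  then have "f = q"
    using f lambda_algebra_subset by (intro eq_if_eq_on_psi quotient_char_ring_extensional) auto
  then show "f \<in> alg_generated Y (lambda_set G H m N B)"
    using q(1) by simp
qed

end

theorem corollary8:
  fixes G H :: "(complex ^ 'd::finite ^ 'd) set" and m N :: nat and B :: "letter list set"
  assumes "reductive_matrix_group G"
    and "subgroup H (matrix_group G)"
    and "cyclic_group (matrix_group H)" and "order (matrix_group H) = m" and "m > 0"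
    and "\<And>h. h \<in> H \<Longrightarrow> \<exists>c. h = mat c"
    and "B \<subseteq> carrier (free_group N)"
    and "alg_generated (rep_variety (matrix_group G) N) (tau G N ` B) = char_ring G N"
  shows "alg_generated (rep_variety (matrix_group G Mod H) N) (lambda_set G H m N B) = quotient_char_ring G H N"
proof -
  have "subgroup G GL"
    using assms(1) by (simp add: reductive_matrix_group_def)
  then interpret trace_generated G H m N B
    using assms by (intro trace_generated.intro scalar_quotient.intro trace_generated_axioms.intro)
  show ?thesis
    using lambda_algebra_subset quotient_char_ring_subset_lambda_algebra by (rule equalityI)
qed

end
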